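(* With notation as in the context, $\mathbb M=\widetilde{\mathbb M}_1$; that is, for $g\in\mathbb G$, the function $\phi(g;\cdot)$ has a nondegenerate critical point in $\Omega_*$ if and only if the set of global maximizers of $\phi(g;\cdot)$ in $\Omega_*$ consists of exactly one point.
   Context: Let $q,m\ge1$, $U^{(1)},\dots,U^{(m)}$ linearly independent real skew-symmetric $q\times q$ matrices, $\mathbb G=\mathbb R^q\times\mathbb R^m$. $U(\tau)=i\sum_j\tau_jU^{(j)}$, $\Omega_*=\{\tau\in\mathbb R^m:\|U(\tau)\|<\pi\}$ (operator norm), and for $g=(x,t)$, $\phi(g;\tau)=\langle U(\tau)\cot U(\tau)x,x\rangle+4t\cdot\tau$, $\tau\in\Omega_*$ (a smooth concave function). $\mathbb M=\{g:\ \exists\theta\in\Omega_*$ with $\nabla_\tau\phi(g;\theta)=0$ and $\det\mathrm{Hess}_\tau\phi(g;\theta)\neq0\}$. $\widetilde{\mathbb M}_1=\{g:$ the set of global maximizers of $\phi(g;\cdot)$ in $\Omega_*$ is a singleton$\}$. *)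

theory Defs
  imports "HOL-Analysis.Analysis"
begin

text \<open>Powers of square matrices.\<close>
primrec cmatpow :: "complex^'q^'q \<Rightarrow> nat \<Rightarrow> complex^'q^'q" where
  "cmatpow A 0 = mat 1"
| "cmatpow A (Suc n) = A ** cmatpow A n"

text \<open>U(tau) = i * sum_j tau_j U^(j), a complex (Hermitian) q x q matrix.\<close>
definition Umat :: "('m::finite \<Rightarrow> real^'q^'q) \<Rightarrow> real^'m \<Rightarrow> complex^'q^'q" where
  "Umat Us \<tau> = (\<chi> a b. \<Sum>j\<in>UNIV. Complex 0 (\<tau>$j) * complex_of_real ((Us j)$a$b))"

text \<open>Matrix function U cot U = cos(U) * (sin(U)/U)^(-1), both factors given by
  their (entire) power series; for norm U < pi the second factor is invertible.\<close>
definition UcotU :: "complex^'q^'q \<Rightarrow> complex^'q^'q" where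
  "UcotU A =
     (\<Sum>k. ((-1)^k / fact (2*k)) *\<^sub>R cmatpow A (2*k)) **
     matrix_inv (\<Sum>k. ((-1)^k / fact (2*k+1)) *\<^sub>R cmatpow A (2*k))"

text \<open>Omega_* = {tau. operator norm of U(tau) < pi}.\<close>
definition Omega :: "('m::finite \<Rightarrow> real^'q^'q) \<Rightarrow> (real^'m) set" where
  "Omega Us = {\<tau>. onorm (\<lambda>v. Umat Us \<tau> *v v) < pi}"

text \<open>phi(g;tau) = <U cot U x, x> + 4 t.tau  with g = (x,t).\<close>
definition phi :: "('m::finite \<Rightarrow> real^'q^'q) \<Rightarrow> real^'q \<Rightarrow> real^'m \<Rightarrow> real^'m \<Rightarrow> real" where
  "phi Us x t \<tau> =
     Re (\<Sum>i\<in>UNIV. (UcotU (Umat Us \<tau>) *v (\<chi> k. complex_of_real (x$k))) $ i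
                     * cnj (complex_of_real (x$i)))
     + 4 * (t \<bullet> \<tau>)"

text \<open>Partial derivatives, gradient condition and Hessian matrix.\<close>
definition partial :: "(real^'m \<Rightarrow> real) \<Rightarrow> 'm \<Rightarrow> real^'m \<Rightarrow> real" where
  "partial f i \<tau> = deriv (\<lambda>s. f (\<tau> + s *\<^sub>R axis i 1)) 0"

definition hess :: "(real^'m \<Rightarrow> real) \<Rightarrow> real^'m \<Rightarrow> real^'m^'m" where
  "hess f \<tau> = (\<chi> i j. partial (\<lambda>\<sigma>. partial f j \<sigma>) i \<tau>)"

end

(* Write U(tau) = i A(tau) with A(tau) real skew-symmetric, so that M(tau) = U(tau)^2 = -A(tau)^2
   is positive semidefinite.  Applying mu cot mu = 1 - sum_n 2 mu^2 / (c_n - mu^2), where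
   c_n = ((n+1) pi)^2, on the eigenvectors of M gives, for ||U(tau)|| < pi,
     phi(x,t;tau) = |x|^2 - 2 sum_n <M (c_n - M)^-1 x, x> + 4 t.tau.
   Differentiating termwise, with y_n = (c_n - M)^-1 x and z_n = (DM.w) y_n, the second derivative
   in a direction w is -4 sum_n c_n (<(c_n - M)^-1 z_n, z_n> + |A(w) y_n|^2) <= 0.  So phi is
   concave on the convex set Omega_*, and w lies in the kernel of the Hessian iff A(w) y_n = 0 = z_n
   for all n.  Along such a flat direction every y_n, hence every term of the series, stays fixed
   and phi is affine.  Therefore a nondegenerate critical point is the unique maximizer (a second
   one would make phi constant on a segment, producing a flat direction), and at a unique maximizer
   the Hessian is nondegenerate (a flat direction would produce a segment of maximizers). *)

theory Submission
  imports Defs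
begin

section \<open>The partial fraction expansion of the cotangent\<close>

lemma Gamma_reflection_real:
  fixes z :: real
  assumes "0 < z" "z < 1"
  shows "Gamma z * Gamma (1 - z) = pi / sin (pi * z)"
proof -
  have "complex_of_real (Gamma z * Gamma (1 - z)) = complex_of_real (pi / sin (pi * z))"
    using Gamma_reflection_complex[of "of_real z"]
    by (simp flip: Gamma_complex_of_real sin_of_real)
  then show ?thesis by (simp only: of_real_eq_iff)
qed

lemma Digamma_reflection_real:
  fixes z :: real
  assumes z: "0 < z" "z < 1"
  shows "Digamma (1 - z) - Digamma z = pi * cot (pi * z)"
proof -
  have sin_nz: "sin (pi * z) \<noteq> 0"
    using z sin_gt_zero[of "pi * z"] by (simp add: mult_less_cancel_left1)
  have not_pole: "z \<notin> \<int>\<^sub>\<le>\<^sub>0" "1 - z \<notin> \<int>\<^sub>\<le>\<^sub>0"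
    using z by (auto elim!: nonpos_Ints_cases)
  have "((\<lambda>s. Gamma s * Gamma (1 - s)) has_field_derivative
        Gamma z * Gamma (1 - z) * (Digamma z - Digamma (1 - z))) (at z)"
    using not_pole by (auto intro!: derivative_eq_intros simp: algebra_simps)
  then have "((\<lambda>s. pi / sin (pi * s)) has_field_derivative
        Gamma z * Gamma (1 - z) * (Digamma z - Digamma (1 - z))) (at z)"
    by (rule has_field_derivative_transform_within_open[of _ _ _ "{0<..<1}"])
       (use z Gamma_reflection_real in auto)
  moreover have "((\<lambda>s. pi / sin (pi * s)) has_field_derivative
        - (pi * (cos (pi * z) * pi)) / (sin (pi * z))\<^sup>2) (at z)"
    using sin_nz by (auto intro!: derivative_eq_intros simp: power2_eq_square)
  ultimately have "pi / sin (pi * z) * (Digamma z - Digamma (1 - z))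
      = - (pi * (cos (pi * z) * pi)) / (sin (pi * z))\<^sup>2"
    using DERIV_unique Gamma_reflection_real[OF z] by metis
  then have "pi / sin (pi * z) * (Digamma (1 - z) - Digamma z) = pi / sin (pi * z) * (pi * cot (pi * z))"
    using sin_nz by (simp add: cot_def power2_eq_square algebra_simps)
  then show ?thesis using sin_nz by simp
qed

lemma cot_partial_fractions:
  fixes z :: real
  assumes z: "0 < z" "z < 1"
  shows "(\<lambda>k. 1 / (z + real k) - 1 / (1 - z + real k)) sums (pi * cot (pi * z))"
proof -
  have "(\<lambda>k. inverse (real (Suc k)) - inverse (1 - z + real k)) sums (Digamma (1 - z) + euler_mascheroni)"
    "(\<lambda>k. inverse (real (Suc k)) - inverse (z + real k)) sums (Digamma z + euler_mascheroni)"
    using summable_Digamma[of "1 - z"] summable_Digamma[of z] z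
    by (simp_all add: Digamma_def summable_sums)
  from sums_diff[OF this] show ?thesis
    by (simp add: Digamma_reflection_real[OF z] divide_inverse)
qed

text \<open>Pair \<open>1/(z+n+1)\<close> with \<open>1/(1-z+n)\<close>; what is left over telescopes.\<close>

lemma x_cot_x_partial_fractions:
  fixes \<mu> :: real
  assumes \<mu>: "0 < \<mu>" "\<mu> < pi"
  shows "(\<lambda>n. 2 * \<mu>\<^sup>2 / ((real (Suc n) * pi)\<^sup>2 - \<mu>\<^sup>2)) sums (1 - \<mu> * cot \<mu>)"
proof -
  define z where "z = \<mu> / pi"
  have z: "0 < z" "z < 1" and \<mu>_eq: "\<mu> = pi * z"
    using \<mu> by (auto simp: z_def)
  define a where "a k = z / (z + real k)" for k
  define b where "b k = z / (1 - z + real k)" for k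
  have "(\<lambda>k. a k - b k) sums (\<mu> * cot \<mu>)"
    using sums_mult[OF cot_partial_fractions[OF z], of z]
    by (simp add: a_def b_def \<mu>_eq right_diff_distrib mult_ac)
  then have "(\<lambda>n. a (Suc n) - b (Suc n)) sums (\<mu> * cot \<mu> - (a 0 - b 0))"
    by (subst sums_Suc_iff[where f = "\<lambda>k. a k - b k"]) simp
  moreover have "b \<longlonglongrightarrow> 0"
    unfolding b_def
    by (intro tendsto_divide_0[OF tendsto_const] filterlim_at_top_imp_at_infinity
        filterlim_tendsto_add_at_top[OF tendsto_const filterlim_real_sequentially])
  then have "(\<lambda>n. b (Suc n) - b n) sums (0 - b 0)"
    by (rule telescope_sums)
  ultimately have "(\<lambda>n. a (Suc n) - b n) sums (\<mu> * cot \<mu> - a 0)"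
    using sums_add by fastforce
  from sums_minus[OF this] have "(\<lambda>n. - (a (Suc n) - b n)) sums (1 - \<mu> * cot \<mu>)"
    using z by (simp add: a_def[of 0])
  moreover have "- (a (Suc n) - b n) = 2 * \<mu>\<^sup>2 / ((real (Suc n) * pi)\<^sup>2 - \<mu>\<^sup>2)" for n
  proof -
    have pos: "real n + 1 - z > 0" "real n + 1 + z > 0" using z by auto
    have den: "(real (Suc n) * pi)\<^sup>2 - \<mu>\<^sup>2 = pi\<^sup>2 * ((real n + 1 - z) * (real n + 1 + z))"
      by (simp add: \<mu>_eq power2_eq_square algebra_simps)
    have "2 * \<mu>\<^sup>2 / ((real (Suc n) * pi)\<^sup>2 - \<mu>\<^sup>2) = 2 * z\<^sup>2 / ((real n + 1 - z) * (real n + 1 + z))"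
      unfolding den by (simp add: \<mu>_eq power_mult_distrib)
    also have "\<dots> = - (a (Suc n) - b n)"
      using pos by (simp add: a_def b_def field_simps power2_eq_square)
    finally show ?thesis ..
  qed
  ultimately show ?thesis by simp
qed

lemma abs_alternating_fact_coeff_le: "\<bar>(-1) ^ k / fact (2 * k + j) :: real\<bar> \<le> inverse (fact k)"
proof -
  have "fact k \<le> (fact (2 * k + j) :: real)" by (intro fact_mono) simp
  then show ?thesis by (simp add: abs_mult power_abs divide_inverse le_imp_inverse_le)
qed

definition sinc_sqrt :: "real \<Rightarrow> real" where
  "sinc_sqrt l = (if l = 0 then 1 else sin (sqrt l) / sqrt l)"

lemma cos_sqrt_series: "0 \<le> l \<Longrightarrow> (\<lambda>k. (-1) ^ k / fact (2 * k) * l ^ k) sums cos (sqrt l)"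
  using cos_series[of "sqrt l"] by (simp add: power_mult)

lemma sinc_sqrt_series: "0 \<le> l \<Longrightarrow> (\<lambda>k. (-1) ^ k / fact (2 * k + 1) * l ^ k) sums sinc_sqrt l"
  using sin_z_over_z_series[of "sqrt l"] powser_sums_zero[of "\<lambda>k. (-1) ^ k / fact (2 * k + 1) :: real"]
  by (cases "l = 0") (simp_all add: sinc_sqrt_def power_mult)

lemma sinc_sqrt_pos: "0 \<le> l \<Longrightarrow> l < pi\<^sup>2 \<Longrightarrow> sinc_sqrt l > 0"
  using real_sqrt_less_iff[of l "pi\<^sup>2"]
  by (auto simp: sinc_sqrt_def intro!: divide_pos_pos sin_gt_zero)

text \<open>\<open>pole_sq n\<close> is the square of the \<open>(n+1)\<close>-st positive pole of \<open>\<mu> cot \<mu>\<close>.\<close>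

definition pole_sq :: "nat \<Rightarrow> real" where
  "pole_sq n = (real (Suc n) * pi)\<^sup>2"

lemma pole_sq_gap:
  assumes "0 \<le> r" "r < pi"
  shows "pole_sq n - r\<^sup>2 \<ge> (real (Suc n))\<^sup>2 * (pi\<^sup>2 - r\<^sup>2)"
proof -
  have "r\<^sup>2 \<le> (real (Suc n))\<^sup>2 * r\<^sup>2" by (simp add: mult_le_cancel_right1)
  then show ?thesis by (simp add: pole_sq_def power_mult_distrib right_diff_distrib)
qed

lemma pole_sq_gt:
  assumes "0 \<le> r" "r < pi"
  shows "pole_sq n > r\<^sup>2"
proof -
  have "pi\<^sup>2 - r\<^sup>2 > 0" using assms by (simp add: power_strict_mono)
  then show ?thesis
    using pole_sq_gap[OF assms, of n] by (smt (verit) mult_pos_pos zero_less_power of_nat_0_less_iff zero_less_Suc)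
qed

lemma pole_sq_ratio_le:
  assumes r: "0 \<le> r" "r < pi"
  shows "pole_sq n / (pole_sq n - r\<^sup>2)\<^sup>2 \<le> pi\<^sup>2 / (pi\<^sup>2 - r\<^sup>2)\<^sup>2 * inverse ((real (Suc n))\<^sup>2)"
proof -
  define a where "a = (real (Suc n))\<^sup>2"
  define g where "g = pi\<^sup>2 - r\<^sup>2"
  have a: "a \<ge> 1" by (simp add: a_def)
  have g: "g > 0" using r by (simp add: g_def power_strict_mono)
  have gap: "pole_sq n - r\<^sup>2 \<ge> a * g" using pole_sq_gap[OF r, of n] by (simp add: a_def g_def)
  have ag: "a * g > 0" using a g by simp
  have "pole_sq n / (pole_sq n - r\<^sup>2)\<^sup>2 \<le> pole_sq n / (a * g)\<^sup>2"
    using gap ag a g pole_sq_gt[OF r, of n]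
    by (intro divide_left_mono power_mono mult_pos_pos zero_less_power) (auto simp: pole_sq_def)
  also have "pole_sq n = a * pi\<^sup>2" by (simp add: pole_sq_def a_def power_mult_distrib)
  also have "a * pi\<^sup>2 / (a * g)\<^sup>2 = pi\<^sup>2 / g\<^sup>2 * inverse a"
    using a g by (simp add: power_mult_distrib power2_eq_square field_simps)
  finally show ?thesis by (simp add: a_def g_def pole_sq_def power_mult_distrib)
qed

lemma cos_sinc_partial_fractions:
  assumes "0 \<le> l" "l < pi\<^sup>2"
  shows "(\<lambda>n. 2 * l / (pole_sq n - l)) sums (1 - cos (sqrt l) / sinc_sqrt l)"
proof (cases "l = 0")
  case False
  define \<mu> where "\<mu> = sqrt l"
  have \<mu>: "0 < \<mu>" "\<mu> < pi" and l: "l = \<mu>\<^sup>2"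
    using assms False real_sqrt_less_iff[of l "pi\<^sup>2"] by (auto simp: \<mu>_def)
  have "cos (sqrt l) / sinc_sqrt l = \<mu> * cot \<mu>"
    using False \<mu> by (simp add: sinc_sqrt_def \<mu>_def[symmetric] cot_def)
  with x_cot_x_partial_fractions[OF \<mu>] show ?thesis
    by (simp add: l pole_sq_def)
qed (simp add: sinc_sqrt_def)

lemma summable_inverse_Suc_squared: "summable (\<lambda>n. inverse ((real (Suc n))\<^sup>2))"
  using summable_Suc_iff[of "\<lambda>n. inverse ((real n)\<^sup>2)"] inverse_power_summable[of 2] by simp

section \<open>Matrices\<close>

lemma matrix_inv_right:
  fixes A :: "'a::semiring_1^'n^'m"
  assumes "invertible A"
  shows "A ** matrix_inv A = mat 1"
  using someI_ex[OF assms[unfolded invertible_def]] by (simp add: matrix_inv_def)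

lemma matrix_inv_left:
  fixes A :: "'a::semiring_1^'n^'m"
  assumes "invertible A"
  shows "matrix_inv A ** A = mat 1"
  using someI_ex[OF assms[unfolded invertible_def]] by (simp add: matrix_inv_def)

lemma matrix_inv_unique:
  fixes A B :: "'a::semiring_1^'n^'n"
  assumes "A ** B = mat 1" "B ** A = mat 1"
  shows "matrix_inv A = B"
proof -
  have inv: "invertible A" using assms by (auto simp: invertible_def)
  have "matrix_inv A = (B ** A) ** matrix_inv A" using assms by simp
  also have "\<dots> = B" by (simp add: matrix_mul_assoc[symmetric] matrix_inv_right[OF inv])
  finally show ?thesis .
qed

lemma matrix_inv_mv_eqI:
  fixes A :: "'a::semiring_1^'n^'n"
  assumes "invertible A" "A *v y = x"
  shows "matrix_inv A *v x = y"
  using assms by (auto simp: matrix_vector_mul_assoc matrix_inv_left)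

lemma matrix_mv_inv:
  fixes A :: "'a::semiring_1^'n^'n"
  assumes "invertible A"
  shows "A *v (matrix_inv A *v x) = x"
  using assms by (simp add: matrix_vector_mul_assoc matrix_inv_right)

lemma scaleR_matrix_vector_mult:
  fixes A :: "'a::real_algebra_1^'n^'m"
  shows "(k *\<^sub>R A) *v v = k *\<^sub>R (A *v v)"
  by (simp add: matrix_vector_mult_def vec_eq_iff scaleR_sum_right)

lemma linear_matrix_vector_mult_left: "linear (\<lambda>X::'a::real_algebra_1^'n^'m. X *v v)"
  by (intro linearI) (simp_all add: matrix_vector_mult_add_rdistrib scaleR_matrix_vector_mult)

lemma bounded_bilinear_matrix_vector_mult: "bounded_bilinear (\<lambda>(X::real^'n^'m) (v::real^'n). X *v v)"
  by (simp add: bilinear_conv_bounded_bilinear[symmetric] bilinear_def linear_matrix_vector_mult_left)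

lemma skew_matrix_inner:
  fixes B :: "real^'n^'n"
  assumes "transpose B = - B"
  shows "(B *v a) \<bullet> b = - (a \<bullet> (B *v b))"
proof -
  have "(B *v a) \<bullet> b = a \<bullet> (transpose B *v b)"
    by (metis dot_lmul_matrix vector_transpose_matrix)
  also have "transpose B *v b = - (B *v b)"
    using assms by (simp add: matrix_vector_mult_def vec_eq_iff sum_negf)
  finally show ?thesis by simp
qed

lemma det_eq_0_iff_kernel:
  fixes H :: "real^'n^'n"
  shows "det H = 0 \<longleftrightarrow> (\<exists>w. w \<noteq> 0 \<and> H *v w = 0)"
proof -
  have "det H \<noteq> 0 \<longleftrightarrow> (\<forall>w. H *v w = 0 \<longrightarrow> w = 0)"
    by (simp add: invertible_det_nz[symmetric] invertible_left_inverse matrix_left_invertible_ker)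
  then show ?thesis by blast
qed

lemma convex_on_onorm_linear_matrix:
  fixes L :: "'v::real_vector \<Rightarrow> 'a::{euclidean_space,real_algebra_1}^'n^'m"
  assumes "linear L"
  shows "convex_on UNIV (\<lambda>s. onorm ((*v) (L s)))"
proof (rule convex_onI)
  fix u :: real and a b :: 'v
  assume u: "0 < u" "u < 1"
  have "(*v) (L ((1 - u) *\<^sub>R a + u *\<^sub>R b)) = (\<lambda>v. (1 - u) *\<^sub>R (L a *v v) + u *\<^sub>R (L b *v v))"
    by (rule ext) (simp add: linear_add[OF assms] linear_scale[OF assms] matrix_vector_mult_add_rdistrib
        scaleR_matrix_vector_mult)
  moreover have "onorm (\<lambda>v. (1 - u) *\<^sub>R (L a *v v) + u *\<^sub>R (L b *v v))
      \<le> onorm (\<lambda>v. (1 - u) *\<^sub>R (L a *v v)) + onorm (\<lambda>v. u *\<^sub>R (L b *v v))"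
    by (intro onorm_triangle bounded_linear_compose[OF bounded_linear_scaleR_right]) simp_all
  moreover have "onorm (\<lambda>v. (1 - u) *\<^sub>R (L a *v v)) + onorm (\<lambda>v. u *\<^sub>R (L b *v v))
      = (1 - u) * onorm ((*v) (L a)) + u * onorm ((*v) (L b))"
    using u by (simp add: onorm_scaleR)
  ultimately show "onorm ((*v) (L ((1 - u) *\<^sub>R a + u *\<^sub>R b)))
      \<le> (1 - u) * onorm ((*v) (L a)) + u * onorm ((*v) (L b))" by simp
qed simp

definition mat_of_real :: "real^'n^'m \<Rightarrow> complex^'n^'m" where
  "mat_of_real X = (\<chi> a b. complex_of_real (X $ a $ b))"

definition vec_of_real :: "real^'n \<Rightarrow> complex^'n" where
  "vec_of_real v = (\<chi> a. complex_of_real (v $ a))"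

lemma mat_of_real_mult: "mat_of_real (X ** Y) = mat_of_real X ** mat_of_real Y"
  by (simp add: mat_of_real_def matrix_matrix_mult_def vec_eq_iff)

lemma mat_of_real_mv: "mat_of_real X *v vec_of_real v = vec_of_real (X *v v)"
  by (simp add: mat_of_real_def vec_of_real_def matrix_vector_mult_def vec_eq_iff)

lemma mat_of_real_mat_1: "mat_of_real (mat 1 :: real^'n^'n) = mat 1"
  by (simp add: mat_of_real_def mat_def vec_eq_iff)

lemma bounded_linear_mat_of_real: "bounded_linear (mat_of_real :: real^'n^'m \<Rightarrow> complex^'n^'m)"
proof (rule bounded_linear_intro[of _ 1])
  fix X :: "real^'n^'m"
  have "norm (mat_of_real X $ a) = norm (X $ a)" for a
    by (simp add: mat_of_real_def norm_vec_def L2_set_def)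
  then show "norm (mat_of_real X) \<le> norm X * 1" by (simp add: norm_vec_def L2_set_def)
qed (simp_all add: mat_of_real_def vec_eq_iff complex_eq_iff)

lemma matrix_inv_mat_of_real:
  fixes S :: "real^'n^'n"
  assumes "invertible S"
  shows "matrix_inv (mat_of_real S) = mat_of_real (matrix_inv S)"
  by (intro matrix_inv_unique)
     (simp_all add: mat_of_real_mult[symmetric] mat_of_real_mat_1 matrix_inv_left[OF assms]
       matrix_inv_right[OF assms])

primrec mat_pow :: "real^'n^'n \<Rightarrow> nat \<Rightarrow> real^'n^'n" where
  "mat_pow X 0 = mat 1"
| "mat_pow X (Suc k) = X ** mat_pow X k"

lemma onorm_mat_pow_le: "onorm ((*v) (mat_pow X k)) \<le> onorm ((*v) X) ^ k"
proof (induction k)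
  case 0
  have "(*v) (mat 1 :: real^'n^'n) = (\<lambda>x. x)" by (rule ext) simp
  then show ?case using onorm_id_le by simp
next
  case (Suc k)
  have "(*v) (mat_pow X (Suc k)) = (*v) X \<circ> (*v) (mat_pow X k)"
    by (rule ext) (simp add: matrix_vector_mul_assoc)
  then have "onorm ((*v) (mat_pow X (Suc k))) \<le> onorm ((*v) X) * onorm ((*v) (mat_pow X k))"
    using onorm_compose[of "(*v) X" "(*v) (mat_pow X k)"] by simp
  also have "\<dots> \<le> onorm ((*v) X) * onorm ((*v) X) ^ k"
    by (intro mult_left_mono Suc onorm_pos_le) simp
  finally show ?case by simp
qed

lemma norm_matrix_le_onorm:
  "norm (X::real^'n^'m) \<le> real CARD('m) * real CARD('n) * onorm ((*v) X)"
proof -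
  have "norm X \<le> (\<Sum>i\<in>UNIV. norm (X $ i))"
    unfolding norm_vec_def by (rule L2_set_le_sum) simp
  also have "\<dots> \<le> (\<Sum>i\<in>(UNIV::'m set). \<Sum>j\<in>(UNIV::'n set). onorm ((*v) X))"
    by (intro sum_mono order_trans[OF norm_le_l1_cart] matrix_component_le_onorm)
  finally show ?thesis by simp
qed

lemma summable_mat_pow_series:
  fixes X :: "real^'n^'n"
  assumes a: "\<And>k. \<bar>a k\<bar> \<le> inverse (fact k)"
  shows "summable (\<lambda>k. a k *\<^sub>R mat_pow X k)"
proof -
  define C where "C = real CARD('n) * real CARD('n)"
  define m where "m = onorm ((*v) X)"
  have "summable (\<lambda>k. C * (inverse (fact k) * m ^ k))"
    by (intro summable_mult summable_exp)
  then show ?thesis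
  proof (rule summable_comparison_test'[where N = 0])
    fix k :: nat
    have "norm (mat_pow X k) \<le> C * m ^ k"
      using norm_matrix_le_onorm[of "mat_pow X k"] onorm_mat_pow_le[of X k]
      by (fastforce simp: C_def m_def intro: order_trans mult_left_mono)
    then have "\<bar>a k\<bar> * norm (mat_pow X k) \<le> inverse (fact k) * (C * m ^ k)"
      by (intro mult_mono[OF a]) simp_all
    then show "norm (a k *\<^sub>R mat_pow X k) \<le> C * (inverse (fact k) * m ^ k)"
      by (simp add: algebra_simps)
  qed
qed

lemma mat_pow_eigenvector: "X *v v = l *\<^sub>R v \<Longrightarrow> mat_pow X k *v v = (l ^ k) *\<^sub>R v"
  by (induction k) (simp_all add: matrix_vector_mul_assoc[symmetric] matrix_vector_mult_scaleR)

lemma mat_pow_series_eigenvector: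
  fixes X :: "real^'n^'n" and v :: "real^'n"
  assumes "summable (\<lambda>k. a k *\<^sub>R mat_pow X k)" and "X *v v = l *\<^sub>R v"
    and "(\<lambda>k. a k * l ^ k) sums L"
  shows "(\<Sum>k. a k *\<^sub>R mat_pow X k) *v v = L *\<^sub>R v"
proof -
  have "bounded_linear (\<lambda>Y::real^'n^'n. Y *v v)"
    by (simp add: linear_conv_bounded_linear[symmetric] linearI matrix_vector_mult_add_rdistrib
        scaleR_matrix_vector_assoc)
  from bounded_linear.sums[OF this summable_sums[OF assms(1)]]
  have "(\<lambda>k. (a k * l ^ k) *\<^sub>R v) sums ((\<Sum>k. a k *\<^sub>R mat_pow X k) *v v)"
    by (simp add: scaleR_matrix_vector_assoc[symmetric] mat_pow_eigenvector[OF assms(2)])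
  with sums_scaleR_left[OF assms(3)] show ?thesis using sums_unique2 by blast
qed

section \<open>Self-adjoint operators\<close>

lemma linear_coefficient_zero:
  fixes b c :: real
  assumes "\<And>e. b * e + c * e\<^sup>2 \<le> 0"
  shows "b = 0"
proof (rule ccontr)
  assume "b \<noteq> 0"
  define k where "k = \<bar>c\<bar> + 1"
  have k: "k > 0" "\<bar>c\<bar> < k" by (simp_all add: k_def)
  have "b * (b / k) + c * (b / k)\<^sup>2 = b\<^sup>2 / k * (1 + c / k)"
    using k by (simp add: power2_eq_square field_simps)
  moreover have "1 + c / k > 0"
    using k by (simp add: field_simps abs_less_iff)
  ultimately have "b * (b / k) + c * (b / k)\<^sup>2 > 0" using \<open>b \<noteq> 0\<close> k by simp
  with assms show False by (smt (verit))
qed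

text \<open>Perturbing \<open>v\<close> along \<open>w = f v - \<mu> v\<close> changes the Rayleigh form by \<open>2 e |w|\<^sup>2 + O(e\<^sup>2)\<close>,
  so maximality forces \<open>w = 0\<close>.\<close>

lemma self_adjoint_Rayleigh_maximizer_eigenvector:
  fixes f :: "'a::euclidean_space \<Rightarrow> 'a"
  assumes f: "linear f" "\<And>a b. f a \<bullet> b = a \<bullet> f b"
    and V: "subspace V" "\<And>v. v \<in> V \<Longrightarrow> f v \<in> V"
    and v: "v \<in> V" "v \<bullet> v = 1" and max: "\<And>u. u \<in> V \<Longrightarrow> f u \<bullet> u \<le> (f v \<bullet> v) * (u \<bullet> u)"
  shows "f v = (f v \<bullet> v) *\<^sub>R v"
proof -
  define \<mu> where "\<mu> = f v \<bullet> v"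
  define w where "w = f v - \<mu> *\<^sub>R v"
  have wV: "w \<in> V"
    unfolding w_def by (intro subspace_diff[OF V(1)] subspace_scale[OF V(1)] V(2) v(1))
  have vw: "v \<bullet> w = 0"
    by (simp add: w_def inner_diff_right \<mu>_def v(2) inner_commute)
  have fvw: "f v \<bullet> w = w \<bullet> w" "w \<bullet> f v = w \<bullet> w"
    using vw by (simp_all add: w_def inner_diff_left inner_diff_right inner_commute)
  have "2 * (w \<bullet> w) = 0"
  proof (rule linear_coefficient_zero)
    fix e :: real
    have "v + e *\<^sub>R w \<in> V" using V(1) v(1) wV by (simp add: subspace_add subspace_scale)
    moreover have "f (v + e *\<^sub>R w) \<bullet> (v + e *\<^sub>R w) - \<mu> * ((v + e *\<^sub>R w) \<bullet> (v + e *\<^sub>R w))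
        = 2 * (w \<bullet> w) * e + (f w \<bullet> w - \<mu> * (w \<bullet> w)) * e\<^sup>2"
      using f(2)[of w v] vw fvw v(2)
      by (simp add: linear_add[OF f(1)] linear_scale[OF f(1)] inner_add_left inner_add_right
          \<mu>_def[symmetric] inner_commute[of v w] power2_eq_square algebra_simps)
    ultimately show "2 * (w \<bullet> w) * e + (f w \<bullet> w - \<mu> * (w \<bullet> w)) * e\<^sup>2 \<le> 0"
      using max unfolding \<mu>_def[symmetric] by (metis diff_le_0_iff_le)
  qed
  then show ?thesis by (simp add: w_def \<mu>_def)
qed

lemma self_adjoint_invariant_subspace_eigenvector:
  fixes f :: "'a::euclidean_space \<Rightarrow> 'a"
  assumes f: "linear f" "\<And>a b. f a \<bullet> b = a \<bullet> f b"
    and V: "subspace V" "\<And>v. v \<in> V \<Longrightarrow> f v \<in> V" "V \<noteq> {0}"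
  obtains v l where "v \<in> V" "v \<noteq> 0" "f v = l *\<^sub>R v"
proof -
  define K where "K = V \<inter> sphere 0 1"
  have cK: "compact K"
    unfolding K_def by (rule closed_Int_compact[OF closed_subspace[OF V(1)] compact_sphere])
  have unit: "(1 / norm u) *\<^sub>R u \<in> K" if "u \<in> V" "u \<noteq> 0" for u
    unfolding K_def using subspace_scale[OF V(1) that(1)] that(2) by simp
  obtain z where "z \<in> V" "z \<noteq> 0" using V(3) subspace_0[OF V(1)] by blast
  then have neK: "K \<noteq> {}" using unit by blast
  have "continuous_on K (\<lambda>v. f v \<bullet> v)"
    using linear_continuous_on[OF linear_conv_bounded_linear[THEN iffD1, OF f(1)]]
    by (intro continuous_intros) auto
  then obtain v where v: "v \<in> K" and max: "\<And>u. u \<in> K \<Longrightarrow> f u \<bullet> u \<le> f v \<bullet> v"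
    using continuous_attains_sup[OF cK neK] by blast
  have vV: "v \<in> V" and v1: "v \<bullet> v = 1" using v by (auto simp: K_def dot_square_norm)
  have "f u \<bullet> u \<le> (f v \<bullet> v) * (u \<bullet> u)" if "u \<in> V" for u
  proof (cases "u = 0")
    case False
    with max[OF unit[OF that]] show ?thesis
      by (simp add: linear_scale[OF f(1)] dot_square_norm divide_le_eq power2_eq_square)
  qed (simp add: linear_0[OF f(1)])
  with self_adjoint_Rayleigh_maximizer_eigenvector[OF f V(1,2) vV v1] have "f v = (f v \<bullet> v) *\<^sub>R v"
    by blast
  moreover have "v \<noteq> 0" using v1 by auto
  ultimately show ?thesis using that vV by blast
qed

lemma self_adjoint_eigenvectors_span:
  fixes f :: "'a::euclidean_space \<Rightarrow> 'a"
  assumes f: "linear f" "\<And>a b. f a \<bullet> b = a \<bullet> f b"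
  shows "span {v. \<exists>l. f v = l *\<^sub>R v} = UNIV"
proof (rule ccontr)
  define E where "E = {v. \<exists>l. f v = l *\<^sub>R v}"
  define V where "V = {y. \<forall>e\<in>E. orthogonal e y}"
  assume "span {v. \<exists>l. f v = l *\<^sub>R v} \<noteq> UNIV"
  then obtain a where "a \<noteq> 0" "\<And>x. x \<in> span E \<Longrightarrow> a \<bullet> x = 0"
    using span_not_UNIV_orthogonal unfolding E_def by blast
  then have "a \<in> V" "a \<noteq> 0"
    by (auto simp: V_def orthogonal_def inner_commute span_base)
  moreover have "f y \<in> V" if "y \<in> V" for y
    unfolding V_def orthogonal_def
  proof (intro CollectI ballI)
    fix e assume "e \<in> E"
    then obtain l where "f e = l *\<^sub>R e" by (auto simp: E_def)
    then show "e \<bullet> f y = 0"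
      using that f(2)[of e y] \<open>e \<in> E\<close> by (simp add: V_def orthogonal_def)
  qed
  ultimately obtain v l where "v \<in> V" "v \<noteq> 0" "f v = l *\<^sub>R v"
    using self_adjoint_invariant_subspace_eigenvector[OF f, of V] subspace_orthogonal_to_vectors
    unfolding V_def by blast
  then show False by (auto simp: V_def E_def orthogonal_def)
qed

lemma coercive_matrix_norm_ge:
  fixes N :: "real^'n^'n"
  assumes coercive: "\<And>v. (N *v v) \<bullet> v \<ge> g * (norm v)\<^sup>2"
  shows "g * norm v \<le> norm (N *v v)"
proof (cases "v = 0")
  case False
  have "g * norm v * norm v \<le> (N *v v) \<bullet> v"
    using coercive[of v] by (simp add: power2_eq_square mult.assoc)
  also have "\<dots> \<le> norm (N *v v) * norm v" by (rule norm_cauchy_schwarz)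
  finally show ?thesis using False by simp
qed simp

lemma coercive_matrix_invertible:
  fixes N :: "real^'n^'n"
  assumes coercive: "\<And>v. (N *v v) \<bullet> v \<ge> g * (norm v)\<^sup>2" and "g > 0"
  shows "invertible N"
proof -
  have "inj ((*v) N)"
  proof (rule injI)
    fix a b assume "N *v a = N *v b"
    then have "g * norm (a - b) \<le> 0"
      using coercive_matrix_norm_ge[OF coercive, of "a - b"] by (simp add: matrix_vector_mult_diff_distrib)
    then show "a = b" using \<open>g > 0\<close> by (simp add: mult_le_0_iff)
  qed
  moreover from this have "surj ((*v) N)"
    by (rule linear_inj_imp_surj[OF matrix_vector_mul_linear])
  ultimately show ?thesis by (simp add: invertible_eq_bij bij_def)
qed

lemma norm_matrix_inv_coercive_le:
  fixes N :: "real^'n^'n"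
  assumes coercive: "\<And>v. (N *v v) \<bullet> v \<ge> g * (norm v)\<^sup>2" and "g > 0"
  shows "norm (matrix_inv N *v v) \<le> norm v / g"
  using coercive_matrix_norm_ge[OF coercive, of "matrix_inv N *v v"] \<open>g > 0\<close>
  by (simp add: matrix_mv_inv[OF coercive_matrix_invertible[OF assms]] field_simps)

lemma matrix_inv_self_adjoint:
  fixes N :: "real^'n^'n"
  assumes "invertible N" and sym: "\<And>a b. (N *v a) \<bullet> b = a \<bullet> (N *v b)"
  shows "(matrix_inv N *v a) \<bullet> b = a \<bullet> (matrix_inv N *v b)"
  using sym[of "matrix_inv N *v a" "matrix_inv N *v b"] by (simp add: matrix_mv_inv[OF assms(1)])

lemma inner_matrix_inv_coercive_ge:
  fixes N :: "real^'n^'n"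
  assumes coercive: "\<And>v. (N *v v) \<bullet> v \<ge> g * (norm v)\<^sup>2" and "g > 0"
  shows "(matrix_inv N *v z) \<bullet> z \<ge> g * (norm (matrix_inv N *v z))\<^sup>2"
  using coercive[of "matrix_inv N *v z"]
  by (simp add: matrix_mv_inv[OF coercive_matrix_invertible[OF assms]] inner_commute)

section \<open>Calculus\<close>

lemma convex_strict_sublevel:
  fixes f :: "'a::real_vector \<Rightarrow> real"
  assumes "convex_on UNIV f"
  shows "convex {x. f x < r}"
proof (rule convexI)
  fix a b :: 'a and u v :: real
  assume ab: "a \<in> {x. f x < r}" "b \<in> {x. f x < r}" and uv: "0 \<le> u" "0 \<le> v" "u + v = 1"
  have "f (u *\<^sub>R a + v *\<^sub>R b) \<le> u * f a + v * f b"
    using assms uv unfolding convex_on_def by blast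
  also have "\<dots> \<le> u * max (f a) (f b) + v * max (f a) (f b)"
    using uv by (intro add_mono mult_left_mono) auto
  also have "\<dots> < r"
    using ab uv(3) by (simp add: distrib_right[symmetric])
  finally show "u *\<^sub>R a + v *\<^sub>R b \<in> {x. f x < r}" by simp
qed

lemma eventually_dominated_tail_le:
  fixes f' :: "nat \<Rightarrow> 'a \<Rightarrow> 'b::real_normed_vector \<Rightarrow> real"
  assumes dom: "\<And>n y h. y \<in> S \<Longrightarrow> \<bar>f' n y h\<bar> \<le> D n * norm h" and D: "summable D" and "e > 0"
  shows "\<forall>\<^sub>F n in sequentially. \<forall>y\<in>S. \<forall>h. norm ((\<Sum>i<n. f' i y h) - (\<Sum>i. f' i y h)) \<le> e * norm h"
proof -
  obtain N where N: "\<And>n. n \<ge> N \<Longrightarrow> norm (\<Sum>i. D (i + n)) < e"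
    using suminf_exist_split[OF \<open>e > 0\<close> D] by blast
  have "norm ((\<Sum>i<n. f' i y h) - (\<Sum>i. f' i y h)) \<le> e * norm h" if "n \<ge> N" "y \<in> S" for n y h
  proof -
    have tail: "summable (\<lambda>i. D (i + n) * norm h)"
      using summable_ignore_initial_segment[OF D, of n] by (intro summable_mult2)
    have "summable (\<lambda>i. f' i y h)"
      by (rule summable_comparison_test'[OF summable_mult2[OF D, of "norm h"]])
         (use dom[OF \<open>y \<in> S\<close>] in \<open>auto simp: mult.commute\<close>)
    then have "norm ((\<Sum>i<n. f' i y h) - (\<Sum>i. f' i y h)) = \<bar>\<Sum>i. f' (i + n) y h\<bar>"
      using suminf_split_initial_segment[of "\<lambda>i. f' i y h" n] by simp
    also have "\<dots> \<le> (\<Sum>i. D (i + n) * norm h)"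
      using dom[OF \<open>y \<in> S\<close>]
      by (intro order_trans[OF summable_rabs suminf_le] summable_comparison_test'[OF tail] tail) auto
    also have "\<dots> = (\<Sum>i. D (i + n)) * norm h"
      by (rule suminf_mult2[symmetric, OF summable_ignore_initial_segment[OF D]])
    also have "\<dots> \<le> e * norm h"
      using N[OF \<open>n \<ge> N\<close>] by (intro mult_right_mono) auto
    finally show ?thesis .
  qed
  then show ?thesis unfolding eventually_sequentially by blast
qed

lemma has_derivative_suminf:
  fixes f :: "nat \<Rightarrow> 'a::real_normed_vector \<Rightarrow> real" and f' :: "nat \<Rightarrow> 'a \<Rightarrow> 'a \<Rightarrow> real"
  assumes S: "open S" "convex S" "x \<in> S"
    and deriv: "\<And>n y. y \<in> S \<Longrightarrow> (f n has_derivative f' n y) (at y)"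
    and dom: "\<And>n y h. y \<in> S \<Longrightarrow> \<bar>f' n y h\<bar> \<le> D n * norm h"
    and D: "summable D"
    and summable: "\<And>y. y \<in> S \<Longrightarrow> summable (\<lambda>n. f n y)"
  shows "((\<lambda>y. \<Sum>n. f n y) has_derivative (\<lambda>h. \<Sum>n. f' n x h)) (at x)"
proof -
  obtain g where g: "\<And>y. y \<in> S \<Longrightarrow> (\<lambda>n. f n y) sums g y \<and>
      (g has_derivative (\<lambda>h. \<Sum>n. f' n y h)) (at y within S)"
    using has_derivative_series[OF S(2) has_derivative_at_withinI[OF deriv]
        eventually_dominated_tail_le[OF dom D] S(3) summable_sums[OF summable[OF S(3)]]] by metis
  have "(g has_derivative (\<lambda>h. \<Sum>n. f' n x h)) (at x)"
    using g[OF S(3)] at_within_open[OF S(3,1)] by simp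
  then show ?thesis
    by (rule has_derivative_transform_within_open[OF _ S(1,3)]) (use g in \<open>simp add: sums_iff\<close>)
qed

lemma has_derivative_quadratic_remainder:
  fixes f :: "'a::real_normed_vector \<Rightarrow> 'b::real_normed_vector"
  assumes "bounded_linear f'"
    and "\<forall>\<^sub>F y in at x. norm (f y - f x - f' (y - x)) \<le> C * (norm (y - x))\<^sup>2"
  shows "(f has_derivative f') (at x)"
proof -
  have "\<forall>\<^sub>F y in at x. norm (f y - f x - f' (y - x)) \<le> C * (norm (y - x))\<^sup>2 \<and> y \<noteq> x"
    using assms(2) eventually_neq_at_within[of x x UNIV] by eventually_elim simp
  then have le: "\<forall>\<^sub>F y in at x. norm (f y - f x - f' (y - x)) / norm (y - x) \<le> C * norm (y - x)"
    by eventually_elim (simp add: divide_le_eq power2_eq_square mult.assoc)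
  have "((\<lambda>y. C * norm (y - x)) \<longlongrightarrow> C * norm (x - x)) (at x)"
    by (intro tendsto_intros)
  then have "((\<lambda>y. C * norm (y - x)) \<longlongrightarrow> 0) (at x)" by simp
  from tendsto_sandwich[OF _ le tendsto_const this]
  have "((\<lambda>y. norm (f y - f x - f' (y - x)) / norm (y - x)) \<longlongrightarrow> 0) (at x)" by simp
  with assms(1) show ?thesis
    unfolding has_derivative_iff_norm by blast
qed

lemma has_derivative_along_line:
  fixes f :: "'a::real_normed_vector \<Rightarrow> real"
  assumes "(f has_derivative f') (at (a + u *\<^sub>R w))"
  shows "((\<lambda>u. f (a + u *\<^sub>R w)) has_real_derivative f' w) (at u)"
proof -
  have "((\<lambda>u. a + u *\<^sub>R w) has_derivative (\<lambda>u. u *\<^sub>R w)) (at u)"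
    by (auto intro!: derivative_eq_intros)
  from has_derivative_compose[OF this assms]
  have "((\<lambda>u. f (a + u *\<^sub>R w)) has_derivative (\<lambda>u. f' (u *\<^sub>R w))) (at u)" .
  moreover have "f' (v *\<^sub>R w) = f' w * v" for v
    using linear_scale[OF has_derivative_linear[OF assms]] by simp
  ultimately show ?thesis by (simp add: has_field_derivative_def)
qed

lemma partial_eq_derivative:
  assumes "(f has_derivative f') (at a)"
  shows "partial f i a = f' (axis i 1)"
  unfolding partial_def using has_derivative_along_line[of f f' a 0] assms
  by (simp add: DERIV_imp_deriv)

lemma linear_sum_axis:
  fixes f :: "real^'n \<Rightarrow> real"
  assumes "linear f"
  shows "f w = (\<Sum>j\<in>UNIV. w $ j * f (axis j 1))"
proof -
  have "f w = f (\<Sum>j\<in>UNIV. w $ j *\<^sub>R axis j 1)"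
    using basis_expansion[of w] by (simp add: scalar_mult_eq_scaleR)
  also have "\<dots> = (\<Sum>j\<in>UNIV. w $ j * f (axis j 1))"
    using assms by (simp add: linear_sum linear_scale)
  finally show ?thesis .
qed

lemma DERIV_zero_where_constant:
  fixes f :: "real \<Rightarrow> real"
  assumes "\<And>u. u \<in> {a<..<b} \<Longrightarrow> f u = c" "u \<in> {a<..<b}" "(f has_real_derivative D) (at u)"
  shows "D = 0"
proof -
  have "(f has_real_derivative 0) (at u)"
    by (rule has_field_derivative_transform_within_open[of "\<lambda>_. c", OF _ open_greaterThanLessThan assms(2)])
       (use assms(1) in auto)
  with assms(3) show ?thesis using DERIV_unique by blast
qed

lemma DERIV_nonincreasing_from_critical_point:
  fixes f f' f'' :: "real \<Rightarrow> real"
  assumes f: "\<And>u. u \<in> {0..b} \<Longrightarrow> (f has_real_derivative f' u) (at u)"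
    and f': "\<And>u. u \<in> {0..b} \<Longrightarrow> (f' has_real_derivative f'' u) (at u)"
    and f'': "\<And>u. u \<in> {0..b} \<Longrightarrow> f'' u \<le> 0"
    and crit: "f' 0 = 0"
    and "0 \<le> a" "a \<le> c" "c \<le> b"
  shows "f c \<le> f a"
proof (rule DERIV_nonpos_imp_nonincreasing[OF \<open>a \<le> c\<close>])
  fix u assume u: "a \<le> u" "u \<le> c"
  have "f' u \<le> f' 0"
  proof (rule DERIV_nonpos_imp_nonincreasing[of 0 u f'])
    fix x assume "0 \<le> x" "x \<le> u"
    then have "x \<in> {0..b}" using u assms by auto
    then show "\<exists>y. (f' has_real_derivative y) (at x) \<and> y \<le> 0" using f' f'' by blast
  qed (use u assms in auto)
  moreover have "u \<in> {0..b}" using u assms by auto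
  ultimately show "\<exists>y. (f has_real_derivative y) (at u) \<and> y \<le> 0"
    using f crit by auto
qed

section \<open>Linear families of skew-symmetric matrices\<close>

text \<open>In the notation of the paper \<open>U(\<tau>) = i A \<tau>\<close>, so \<open>M \<tau> = U(\<tau>)\<^sup>2\<close> and
  \<open>rho \<tau>\<close> is the operator norm of \<open>U(\<tau>)\<close>.\<close>

locale skew_family =
  fixes Us :: "'m::finite \<Rightarrow> real^'q::finite^'q"
  assumes skew: "\<forall>j. transpose (Us j) = - Us j"
begin

definition A :: "real^'m \<Rightarrow> real^'q^'q" where
  "A s = (\<Sum>j\<in>UNIV. (s $ j) *\<^sub>R Us j)"

definition M :: "real^'m \<Rightarrow> real^'q^'q" where
  "M s = - (A s ** A s)"

definition rho :: "real^'m \<Rightarrow> real" where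
  "rho s = onorm ((*v) (A s))"

definition lipA :: real where
  "lipA = (\<Sum>j\<in>UNIV. onorm ((*v) (Us j)))"

definition resolvent :: "real \<Rightarrow> real^'m \<Rightarrow> real^'q^'q" where
  "resolvent c s = matrix_inv (c *\<^sub>R mat 1 - M s)"

lemma linear_A: "linear A"
  by (intro linearI) (simp_all add: A_def scaleR_add_left sum.distrib scaleR_sum_right)

lemma A_add: "A (s + h) = A s + A h"
  by (rule linear_add[OF linear_A])

lemma A_scale: "A (c *\<^sub>R s) = c *\<^sub>R A s"
  by (rule linear_scale[OF linear_A])

lemma transpose_A: "transpose (A s) = - A s"
proof -
  have "linear (transpose :: real^'q^'q \<Rightarrow> _)"
    by (intro linearI) (simp_all add: transpose_def vec_eq_iff)
  then show ?thesis using skew by (simp add: A_def linear_sum transpose_scalar sum_negf)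
qed

lemma A_skew: "(A s *v a) \<bullet> b = - (a \<bullet> (A s *v b))"
  by (rule skew_matrix_inner[OF transpose_A])

lemma M_mv: "M s *v v = - (A s *v (A s *v v))"
proof -
  have "(- X) *v v = - (X *v v)" for X :: "real^'q^'q"
    by (simp add: matrix_vector_mult_def vec_eq_iff sum_negf)
  then show ?thesis by (simp add: M_def matrix_vector_mul_assoc)
qed

lemma inner_M: "(M s *v a) \<bullet> b = (A s *v a) \<bullet> (A s *v b)"
  unfolding M_mv using A_skew[of s "A s *v a" b] by simp

lemma M_self_adjoint: "(M s *v a) \<bullet> b = a \<bullet> (M s *v b)"
  unfolding inner_M using inner_M[of s b a] by (simp add: inner_commute)

lemma rho_nonneg: "rho s \<ge> 0"
  unfolding rho_def by (rule onorm_pos_le) simp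

lemma norm_A_le: "norm (A s *v v) \<le> rho s * norm v"
  unfolding rho_def by (rule onorm) simp

lemma norm_M_le: "norm (M s *v v) \<le> (rho s)\<^sup>2 * norm v"
proof -
  have "norm (M s *v v) \<le> rho s * norm (A s *v v)" by (simp add: M_mv norm_A_le)
  also have "\<dots> \<le> rho s * (rho s * norm v)" by (rule mult_left_mono[OF norm_A_le rho_nonneg])
  finally show ?thesis by (simp add: power2_eq_square)
qed

lemma inner_M_le: "(M s *v v) \<bullet> v \<le> (rho s)\<^sup>2 * (norm v)\<^sup>2"
proof -
  have "(M s *v v) \<bullet> v = (norm (A s *v v))\<^sup>2" by (simp add: inner_M power2_norm_eq_inner)
  also have "\<dots> \<le> (rho s * norm v)\<^sup>2" by (rule power_mono[OF norm_A_le]) simp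
  finally show ?thesis by (simp add: power_mult_distrib)
qed

lemma inner_M_nonneg: "(M s *v v) \<bullet> v \<ge> 0"
  by (simp add: inner_M)

lemma norm_A_le_lipA: "norm (A h *v v) \<le> lipA * norm h * norm v"
proof -
  have "norm (A h *v v) = norm (\<Sum>j\<in>UNIV. (h $ j) *\<^sub>R (Us j *v v))"
    unfolding A_def
    by (simp add: linear_sum[OF linear_matrix_vector_mult_left] scaleR_matrix_vector_mult)
  also have "\<dots> \<le> (\<Sum>j\<in>UNIV. \<bar>h $ j\<bar> * norm (Us j *v v))"
    by (rule order_trans[OF norm_sum]) simp
  also have "\<dots> \<le> (\<Sum>j\<in>UNIV. norm h * (onorm ((*v) (Us j)) * norm v))"
    by (intro sum_mono mult_mono component_le_norm_cart onorm) auto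
  also have "\<dots> = lipA * norm h * norm v"
    by (simp add: lipA_def sum_distrib_left sum_distrib_right algebra_simps)
  finally show ?thesis .
qed

lemma lipA_nonneg: "lipA \<ge> 0"
  unfolding lipA_def by (intro sum_nonneg onorm_pos_le) simp

lemma rho_le_lipA: "rho s \<le> lipA * norm s"
  unfolding rho_def by (rule onorm_le) (use norm_A_le_lipA in auto)

lemma convex_rho: "convex_on UNIV rho"
  unfolding rho_def[abs_def] by (rule convex_on_onorm_linear_matrix[OF linear_A])

lemma continuous_rho: "continuous_on UNIV rho"
  by (rule convex_on_continuous[OF open_UNIV convex_rho])

lemma rho_sublevel: "open {s. rho s < r}" "convex {s. rho s < r}"
  by (simp_all add: open_Collect_less[OF continuous_rho continuous_on_const]
      convex_strict_sublevel[OF convex_rho])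

subsection \<open>The resolvent of \<open>M\<close>\<close>

lemma shifted_M_mv: "(c *\<^sub>R mat 1 - M s) *v v = c *\<^sub>R v - M s *v v"
  by (simp add: matrix_vector_mult_diff_rdistrib scaleR_matrix_vector_assoc[symmetric])

lemma shifted_M_self_adjoint: "((c *\<^sub>R mat 1 - M s) *v a) \<bullet> b = a \<bullet> ((c *\<^sub>R mat 1 - M s) *v b)"
  unfolding shifted_M_mv by (simp add: inner_diff_left inner_diff_right M_self_adjoint)

lemma shifted_M_coercive: "((c *\<^sub>R mat 1 - M s) *v v) \<bullet> v \<ge> (c - (rho s)\<^sup>2) * (norm v)\<^sup>2"
  using inner_M_le[of s v] unfolding shifted_M_mv
  by (simp add: inner_diff_left power2_norm_eq_inner algebra_simps)

context
  fixes c s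
  assumes c: "c > (rho s)\<^sup>2"
begin

lemma invertible_shifted_M: "invertible (c *\<^sub>R mat 1 - M s)"
  by (rule coercive_matrix_invertible[OF shifted_M_coercive]) (use c in simp)

lemma shifted_M_resolvent: "(c *\<^sub>R mat 1 - M s) *v (resolvent c s *v v) = v"
  unfolding resolvent_def by (rule matrix_mv_inv[OF invertible_shifted_M])

lemma resolvent_eqI: "(c *\<^sub>R mat 1 - M s) *v y = x \<Longrightarrow> resolvent c s *v x = y"
  unfolding resolvent_def by (rule matrix_inv_mv_eqI[OF invertible_shifted_M])

lemma norm_resolvent_le: "norm (resolvent c s *v v) \<le> norm v / (c - (rho s)\<^sup>2)"
  unfolding resolvent_def by (rule norm_matrix_inv_coercive_le[OF shifted_M_coercive]) (use c in simp)

lemma resolvent_self_adjoint: "(resolvent c s *v a) \<bullet> b = a \<bullet> (resolvent c s *v b)"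
  unfolding resolvent_def by (rule matrix_inv_self_adjoint[OF invertible_shifted_M shifted_M_self_adjoint])

lemma inner_resolvent_ge: "(resolvent c s *v z) \<bullet> z \<ge> (c - (rho s)\<^sup>2) * (norm (resolvent c s *v z))\<^sup>2"
  unfolding resolvent_def by (rule inner_matrix_inv_coercive_ge[OF shifted_M_coercive]) (use c in simp)

lemma inner_resolvent_nonneg: "(resolvent c s *v z) \<bullet> z \<ge> 0"
  using inner_resolvent_ge[of z] c by (smt (verit) zero_le_mult_iff zero_le_power2)

lemma inner_resolvent_eq_0_iff: "(resolvent c s *v z) \<bullet> z = 0 \<longleftrightarrow> z = 0"
proof
  assume "(resolvent c s *v z) \<bullet> z = 0"
  then have "(c - (rho s)\<^sup>2) * (norm (resolvent c s *v z))\<^sup>2 \<le> 0"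
    using inner_resolvent_ge[of z] by simp
  then have "resolvent c s *v z = 0"
    using c by (metis diff_gt_0_iff_gt mult_le_0_iff not_less power2_less_eq_zero_iff norm_eq_zero)
  then show "z = 0" using shifted_M_resolvent[of z] by simp
qed simp

lemma M_resolvent: "M s *v (resolvent c s *v x) = c *\<^sub>R (resolvent c s *v x) - x"
  using shifted_M_resolvent[of x] unfolding shifted_M_mv by (simp add: algebra_simps)

end

subsection \<open>\<open>\<phi>\<close> as a series\<close>

definition cos_M :: "real^'m \<Rightarrow> real^'q^'q" where
  "cos_M s = (\<Sum>k. ((-1) ^ k / fact (2 * k)) *\<^sub>R mat_pow (M s) k)"

definition sinc_M :: "real^'m \<Rightarrow> real^'q^'q" where
  "sinc_M s = (\<Sum>k. ((-1) ^ k / fact (2 * k + 1)) *\<^sub>R mat_pow (M s) k)"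

lemma summable_cos_M: "summable (\<lambda>k. ((-1) ^ k / fact (2 * k)) *\<^sub>R mat_pow (M s) k)"
  using summable_mat_pow_series[OF abs_alternating_fact_coeff_le[where j = 0]] by simp

lemma summable_sinc_M: "summable (\<lambda>k. ((-1) ^ k / fact (2 * k + 1)) *\<^sub>R mat_pow (M s) k)"
  by (rule summable_mat_pow_series[OF abs_alternating_fact_coeff_le])

lemma M_eigenvalue_bounds:
  assumes "M s *v v = l *\<^sub>R v" "v \<noteq> 0"
  shows "0 \<le> l" "l \<le> (rho s)\<^sup>2"
proof -
  have "(M s *v v) \<bullet> v = l * (norm v)\<^sup>2" "(norm v)\<^sup>2 > 0"
    using assms by (simp_all add: power2_norm_eq_inner)
  then show "0 \<le> l" "l \<le> (rho s)\<^sup>2"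
    using inner_M_nonneg[of s v] inner_M_le[of s v] by (simp_all add: zero_le_mult_iff)
qed

lemma cos_M_eigenvector: "M s *v v = l *\<^sub>R v \<Longrightarrow> 0 \<le> l \<Longrightarrow> cos_M s *v v = cos (sqrt l) *\<^sub>R v"
  unfolding cos_M_def by (rule mat_pow_series_eigenvector[OF summable_cos_M _ cos_sqrt_series])

lemma sinc_M_eigenvector: "M s *v v = l *\<^sub>R v \<Longrightarrow> 0 \<le> l \<Longrightarrow> sinc_M s *v v = sinc_sqrt l *\<^sub>R v"
  unfolding sinc_M_def by (rule mat_pow_series_eigenvector[OF summable_sinc_M _ sinc_sqrt_series])

lemma M_eigenvectors_span: "span {v. \<exists>l. M s *v v = l *\<^sub>R v} = UNIV"
  by (rule self_adjoint_eigenvectors_span[OF matrix_vector_mul_linear M_self_adjoint])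

lemma M_eigenvector_rho_lt_pi:
  assumes "rho s < pi" "M s *v v = l *\<^sub>R v" "v \<noteq> 0"
  shows "0 \<le> l" "l < pi\<^sup>2" "sinc_sqrt l > 0"
proof -
  have "(rho s)\<^sup>2 < pi\<^sup>2" using assms(1) rho_nonneg by (simp add: power_strict_mono)
  then show "0 \<le> l" "l < pi\<^sup>2" "sinc_sqrt l > 0"
    using M_eigenvalue_bounds[OF assms(2,3)] sinc_sqrt_pos by auto
qed

lemma invertible_sinc_M:
  assumes "rho s < pi"
  shows "invertible (sinc_M s)"
proof -
  have "{v. \<exists>l. M s *v v = l *\<^sub>R v} \<subseteq> range ((*v) (sinc_M s))"
  proof clarify
    fix v l assume eig: "M s *v v = l *\<^sub>R v"
    show "v \<in> range ((*v) (sinc_M s))"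
    proof (cases "v = 0")
      case False
      note l = M_eigenvector_rho_lt_pi[OF assms eig False]
      have "sinc_M s *v ((1 / sinc_sqrt l) *\<^sub>R v) = v"
        using sinc_M_eigenvector[OF eig l(1)] l(3) by (simp add: matrix_vector_mult_scaleR)
      then show ?thesis by (metis rangeI)
    qed (metis matrix_vector_mult_0_right rangeI)
  qed
  then have "span {v. \<exists>l. M s *v v = l *\<^sub>R v} \<subseteq> range ((*v) (sinc_M s))"
    by (rule span_minimal[OF _ linear_subspace_image[OF matrix_vector_mul_linear subspace_UNIV]])
  then have "surj ((*v) (sinc_M s))" using M_eigenvectors_span by auto
  moreover from this have "inj ((*v) (sinc_M s))"
    by (rule linear_surj_imp_inj[OF matrix_vector_mul_linear])
  ultimately show ?thesis by (simp add: invertible_eq_bij bij_def)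
qed

lemma resolvent_eigenvector:
  assumes "M s *v v = l *\<^sub>R v" and c: "c > (rho s)\<^sup>2"
  shows "resolvent c s *v v = (1 / (c - l)) *\<^sub>R v"
proof (cases "v = 0")
  case False
  have "c - l > 0" using M_eigenvalue_bounds(2)[OF assms(1) False] c by simp
  have "(c *\<^sub>R mat 1 - M s) *v ((1 / (c - l)) *\<^sub>R v) = (1 / (c - l)) *\<^sub>R ((c - l) *\<^sub>R v)"
    by (simp only: shifted_M_mv matrix_vector_mult_scaleR assms(1) scaleR_diff_left)
  then show ?thesis
    using \<open>c - l > 0\<close> by (intro resolvent_eqI[OF c]) simp
qed simp

lemma norm_M_resolvent_le:
  assumes r: "rho s < pi"
  shows "norm (M s *v (resolvent (pole_sq n) s *v v))
    \<le> ((rho s)\<^sup>2 * norm v / (pi\<^sup>2 - (rho s)\<^sup>2)) * inverse ((real (Suc n))\<^sup>2)"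
proof -
  have c: "pole_sq n > (rho s)\<^sup>2" by (rule pole_sq_gt[OF rho_nonneg r])
  have gap: "pole_sq n - (rho s)\<^sup>2 \<ge> (real (Suc n))\<^sup>2 * (pi\<^sup>2 - (rho s)\<^sup>2)"
    by (rule pole_sq_gap[OF rho_nonneg r])
  have "pi\<^sup>2 - (rho s)\<^sup>2 > 0" using r rho_nonneg by (simp add: power_strict_mono)
  then have pos: "(real (Suc n))\<^sup>2 * (pi\<^sup>2 - (rho s)\<^sup>2) > 0" by simp
  have "norm (M s *v (resolvent (pole_sq n) s *v v)) \<le> (rho s)\<^sup>2 * norm (resolvent (pole_sq n) s *v v)"
    by (rule norm_M_le)
  also have "\<dots> \<le> (rho s)\<^sup>2 * (norm v / (pole_sq n - (rho s)\<^sup>2))"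
    by (intro mult_left_mono norm_resolvent_le[OF c]) simp
  also have "\<dots> \<le> (rho s)\<^sup>2 * (norm v / ((real (Suc n))\<^sup>2 * (pi\<^sup>2 - (rho s)\<^sup>2)))"
    using gap pos by (intro mult_left_mono divide_left_mono) simp_all
  also have "\<dots> = ((rho s)\<^sup>2 * norm v / (pi\<^sup>2 - (rho s)\<^sup>2)) * inverse ((real (Suc n))\<^sup>2)"
    by (simp add: field_simps)
  finally show ?thesis .
qed

lemma summable_M_resolvent:
  assumes "rho s < pi"
  shows "summable (\<lambda>n. M s *v (resolvent (pole_sq n) s *v v))"
  by (rule summable_comparison_test'[OF summable_mult[OF summable_inverse_Suc_squared]
        norm_M_resolvent_le[OF assms]])

lemma cot_M_partial_fractions_eigenvector:
  assumes r: "rho s < pi" and eig: "M s *v v = l *\<^sub>R v"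
  shows "cos_M s *v (matrix_inv (sinc_M s) *v v) = v - 2 *\<^sub>R (\<Sum>n. M s *v (resolvent (pole_sq n) s *v v))"
proof (cases "v = 0")
  case False
  note l = M_eigenvector_rho_lt_pi[OF r eig False]
  have "M s *v (resolvent (pole_sq n) s *v v) = (l / (pole_sq n - l)) *\<^sub>R v" for n
    using resolvent_eigenvector[OF eig pole_sq_gt[OF rho_nonneg r]]
    by (simp add: matrix_vector_mult_scaleR eig)
  then have "(\<lambda>n. 2 *\<^sub>R (M s *v (resolvent (pole_sq n) s *v v))) sums
      ((1 - cos (sqrt l) / sinc_sqrt l) *\<^sub>R v)"
    using sums_scaleR_left[OF cos_sinc_partial_fractions[OF l(1,2)], of v] by simp
  then have "v - 2 *\<^sub>R (\<Sum>n. M s *v (resolvent (pole_sq n) s *v v)) = (cos (sqrt l) / sinc_sqrt l) *\<^sub>R v"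
    using suminf_scaleR_right[OF summable_M_resolvent[OF r], of 2 v]
    by (simp add: sums_iff algebra_simps)
  moreover have "matrix_inv (sinc_M s) *v v = (1 / sinc_sqrt l) *\<^sub>R v"
    using sinc_M_eigenvector[OF eig l(1)] l(3)
    by (intro matrix_inv_mv_eqI[OF invertible_sinc_M[OF r]]) (simp add: matrix_vector_mult_scaleR)
  ultimately show ?thesis
    using cos_M_eigenvector[OF eig l(1)] by (simp add: matrix_vector_mult_scaleR)
qed simp

text \<open>Both sides are linear in \<open>v\<close> and agree on the eigenvectors of \<open>M\<close>, which span.\<close>

lemma cot_M_partial_fractions:
  assumes r: "rho s < pi"
  shows "cos_M s *v (matrix_inv (sinc_M s) *v v) = v - 2 *\<^sub>R (\<Sum>n. M s *v (resolvent (pole_sq n) s *v v))"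
proof -
  define S where "S v = (\<Sum>n. M s *v (resolvent (pole_sq n) s *v v))" for v
  have "linear S"
    by (intro linearI)
      (simp_all add: S_def suminf_add[OF summable_M_resolvent[OF r] summable_M_resolvent[OF r]]
        suminf_scaleR_right[OF summable_M_resolvent[OF r]] matrix_vector_right_distrib
        matrix_vector_mult_scaleR)
  then have L: "linear (\<lambda>v. v - 2 *\<^sub>R S v)"
    by (intro linearI) (simp_all add: linear_add linear_scale algebra_simps)
  have R: "linear (\<lambda>v. cos_M s *v (matrix_inv (sinc_M s) *v v))"
    by (intro linear_compose[unfolded o_def, OF matrix_vector_mul_linear matrix_vector_mul_linear])
  have "v \<in> span {v. \<exists>l. M s *v v = l *\<^sub>R v}" by (simp add: M_eigenvectors_span)
  then show ?thesis
    using linear_eq_on_span[OF R L, of "{v. \<exists>l. M s *v v = l *\<^sub>R v}" v]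
      cot_M_partial_fractions_eigenvector[OF r] by (auto simp: S_def)
qed

lemma Umat_eq: "Umat Us s = (\<chi> a b. \<i> * complex_of_real (A s $ a $ b))"
proof -
  have "Complex 0 t = \<i> * complex_of_real t" for t by (simp add: complex_eq_iff)
  then show ?thesis
    by (simp add: Umat_def A_def vec_eq_iff sum_component sum_distrib_left mult.assoc)
qed

lemma Umat_squared: "Umat Us s ** Umat Us s = mat_of_real (M s)"
proof -
  have "(\<i> * complex_of_real a) * (\<i> * complex_of_real b) = - complex_of_real (a * b)" for a b
    by (simp add: algebra_simps)
  then show ?thesis
    by (simp add: Umat_eq mat_of_real_def M_def matrix_matrix_mult_def vec_eq_iff sum_negf)
qed

lemma cmatpow_Umat_even: "cmatpow (Umat Us s) (2 * k) = mat_of_real (mat_pow (M s) k)"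
proof (induction k)
  case (Suc k)
  have "cmatpow (Umat Us s) (2 * Suc k) = (Umat Us s ** Umat Us s) ** cmatpow (Umat Us s) (2 * k)"
    by (simp add: matrix_mul_assoc)
  then show ?case by (simp add: Umat_squared Suc mat_of_real_mult)
qed (simp add: mat_of_real_mat_1)

lemma UcotU_Umat:
  assumes "rho s < pi"
  shows "UcotU (Umat Us s) = mat_of_real (cos_M s ** matrix_inv (sinc_M s))"
proof -
  have "(\<Sum>k. ((-1) ^ k / fact (2 * k)) *\<^sub>R cmatpow (Umat Us s) (2 * k)) = mat_of_real (cos_M s)"
    using bounded_linear.suminf[OF bounded_linear_mat_of_real summable_cos_M]
    by (simp add: cos_M_def cmatpow_Umat_even linear_scale[OF bounded_linear.linear[OF bounded_linear_mat_of_real]])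
  moreover have "(\<Sum>k. ((-1) ^ k / fact (2 * k + 1)) *\<^sub>R cmatpow (Umat Us s) (2 * k)) = mat_of_real (sinc_M s)"
    using bounded_linear.suminf[OF bounded_linear_mat_of_real summable_sinc_M]
    by (simp add: sinc_M_def cmatpow_Umat_even linear_scale[OF bounded_linear.linear[OF bounded_linear_mat_of_real]])
  ultimately show ?thesis
    by (simp add: UcotU_def matrix_inv_mat_of_real[OF invertible_sinc_M[OF assms]] mat_of_real_mult)
qed

definition phi_term :: "real^'q \<Rightarrow> nat \<Rightarrow> real^'m \<Rightarrow> real" where
  "phi_term x n s = 2 * (x \<bullet> x) - 2 * pole_sq n * (x \<bullet> (resolvent (pole_sq n) s *v x))"

lemma phi_term_eq:
  assumes "rho s < pi"
  shows "phi_term x n s = - 2 * ((M s *v (resolvent (pole_sq n) s *v x)) \<bullet> x)"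
proof -
  have "(M s *v (resolvent (pole_sq n) s *v x)) \<bullet> x
      = pole_sq n * ((resolvent (pole_sq n) s *v x) \<bullet> x) - x \<bullet> x"
    by (simp add: M_resolvent[OF pole_sq_gt[OF rho_nonneg assms]] inner_diff_left)
  then show ?thesis
    by (simp add: phi_term_def inner_commute[of x "resolvent (pole_sq n) s *v x"] algebra_simps)
qed

lemma phi_eq_series:
  assumes r: "rho s < pi"
  shows "phi Us x t s = x \<bullet> x + (\<Sum>n. phi_term x n s) + 4 * (t \<bullet> s)"
proof -
  have inner_x: "bounded_linear (\<lambda>v. v \<bullet> x)" by (rule bounded_linear_inner_left)
  have "Re (\<Sum>i\<in>UNIV. (UcotU (Umat Us s) *v (\<chi> k. complex_of_real (x $ k))) $ i * cnj (complex_of_real (x $ i)))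
      = (cos_M s *v (matrix_inv (sinc_M s) *v x)) \<bullet> x"
    using mat_of_real_mv[of "cos_M s ** matrix_inv (sinc_M s)" x]
    by (simp add: UcotU_Umat[OF r] vec_of_real_def inner_vec_def matrix_vector_mul_assoc vec_eq_iff)
  also have "\<dots> = x \<bullet> x - 2 * (\<Sum>n. (M s *v (resolvent (pole_sq n) s *v x)) \<bullet> x)"
    using bounded_linear.suminf[OF inner_x summable_M_resolvent[OF r]]
    by (simp add: cot_M_partial_fractions[OF r] inner_diff_left)
  also have "\<dots> = x \<bullet> x + (\<Sum>n. phi_term x n s)"
    using suminf_mult[OF bounded_linear.summable[OF inner_x summable_M_resolvent[OF r]], of "- 2"]
    by (simp add: phi_term_eq[OF r])
  finally show ?thesis by (simp add: phi_def)
qed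

lemma summable_phi_term:
  assumes "rho s < pi"
  shows "summable (\<lambda>n. phi_term x n s)"
  using summable_mult[OF bounded_linear.summable[OF bounded_linear_inner_left
        summable_M_resolvent[OF assms]], of "- 2"]
  by (simp add: phi_term_eq[OF assms])

subsection \<open>Derivatives of \<open>\<phi>\<close>\<close>

definition dM :: "real^'m \<Rightarrow> real^'m \<Rightarrow> real^'q \<Rightarrow> real^'q" where
  "dM s h v = - (A s *v (A h *v v)) - A h *v (A s *v v)"

lemma M_add: "M (s + h) *v v = M s *v v + dM s h v + M h *v v"
  by (simp add: M_mv dM_def A_add matrix_vector_mult_add_rdistrib matrix_vector_right_distrib algebra_simps)

lemma dM_base_add: "dM (a + b) h v = dM a h v + dM b h v"
  and dM_base_scale: "dM (k *\<^sub>R a) h v = k *\<^sub>R dM a h v"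
  and dM_dir_add: "dM s (a + b) v = dM s a v + dM s b v"
  and dM_dir_scale: "dM s (k *\<^sub>R a) v = k *\<^sub>R dM s a v"
  and dM_vec_diff: "dM s h (v - u) = dM s h v - dM s h u"
  by (simp_all add: dM_def A_add A_scale matrix_vector_mult_add_rdistrib matrix_vector_right_distrib
      scaleR_matrix_vector_mult matrix_vector_mult_scaleR matrix_vector_mult_diff_distrib algebra_simps)

lemma dM_self_adjoint: "dM s h a \<bullet> b = a \<bullet> dM s h b"
  using A_skew[of s "A h *v a" b] A_skew[of h a "A s *v b"] A_skew[of h "A s *v a" b]
    A_skew[of s a "A h *v b"]
  by (simp add: dM_def inner_diff_left inner_diff_right)

lemma inner_dM_self: "y \<bullet> dM h w y = 2 * ((A h *v y) \<bullet> (A w *v y))"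
  using A_skew[of h y "A w *v y"] A_skew[of w y "A h *v y"]
  by (simp add: dM_def inner_diff_right inner_commute)

lemma norm_dM_le: "norm (dM s h v) \<le> 2 * rho s * lipA * norm h * norm v"
proof -
  have "norm (A s *v (A h *v v)) \<le> rho s * (lipA * norm h * norm v)"
    by (rule order_trans[OF norm_A_le mult_left_mono[OF norm_A_le_lipA rho_nonneg]])
  moreover have "norm (A h *v (A s *v v)) \<le> lipA * norm h * (rho s * norm v)"
    by (rule order_trans[OF norm_A_le_lipA mult_left_mono[OF norm_A_le]]) (simp add: lipA_nonneg)
  moreover have "norm (dM s h v) \<le> norm (A s *v (A h *v v)) + norm (A h *v (A s *v v))"
    unfolding dM_def using norm_triangle_ineq4[of "- (A s *v (A h *v v))"] by simp
  ultimately show ?thesis by (simp add: algebra_simps)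
qed

lemma norm_M_le_lipA: "norm (M h *v v) \<le> lipA\<^sup>2 * (norm h)\<^sup>2 * norm v"
proof -
  have "norm (M h *v v) \<le> lipA * norm h * (lipA * norm h * norm v)"
    unfolding M_mv norm_minus_cancel
    by (rule order_trans[OF norm_A_le_lipA mult_left_mono[OF norm_A_le_lipA]]) (simp add: lipA_nonneg)
  then show ?thesis by (simp add: power2_eq_square algebra_simps)
qed

lemma norm_dM_le_lipA: "norm (dM h w v) \<le> 2 * lipA\<^sup>2 * norm h * norm w * norm v"
proof -
  have "2 * rho h * lipA * norm w * norm v \<le> 2 * (lipA * norm h) * lipA * norm w * norm v"
    using rho_le_lipA[of h] lipA_nonneg by (intro mult_right_mono) auto
  then show ?thesis
    using norm_dM_le[of h w v] by (simp add: power2_eq_square algebra_simps)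
qed

lemma resolvent_diff:
  fixes x :: "real^'q"
  assumes c: "c > (rho s)\<^sup>2" and c': "c > (rho (s + h))\<^sup>2"
  defines "y' \<equiv> resolvent c (s + h) *v x"
  shows "y' - resolvent c s *v x = resolvent c s *v (dM s h y' + M h *v y')"
proof -
  have "(c *\<^sub>R mat 1 - M s) *v y' = x + (dM s h y' + M h *v y')"
    using shifted_M_resolvent[OF c', of x]
    unfolding y'_def[symmetric] shifted_M_mv M_add by (simp add: algebra_simps)
  then have "resolvent c s *v (x + (dM s h y' + M h *v y')) = y'" by (rule resolvent_eqI[OF c])
  then show ?thesis by (simp add: matrix_vector_right_distrib algebra_simps)
qed

lemma eventually_resolvent_gap:
  assumes "c > (rho s)\<^sup>2"
  shows "\<forall>\<^sub>F y in at s. c - (rho y)\<^sup>2 > (c - (rho s)\<^sup>2) / 2"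
proof -
  have "(rho \<longlongrightarrow> rho s) (at s)"
    using continuous_rho by (simp add: continuous_on_eq_continuous_at continuous_at)
  then have "((\<lambda>y. c - (rho y)\<^sup>2) \<longlongrightarrow> c - (rho s)\<^sup>2) (at s)"
    by (intro tendsto_intros)
  moreover have "(c - (rho s)\<^sup>2) / 2 < c - (rho s)\<^sup>2" using assms by (simp add: field_simps)
  ultimately show ?thesis by (rule order_tendstoD)
qed

context
  fixes c s h and x :: "real^'q"
  assumes c: "c > (rho s)\<^sup>2" and c': "c > (rho (s + h))\<^sup>2"
begin

lemma norm_resolvent_diff_le:
  "norm (resolvent c (s + h) *v x - resolvent c s *v x)
    \<le> (2 * rho s * lipA * norm h + lipA\<^sup>2 * (norm h)\<^sup>2) * norm (resolvent c (s + h) *v x) / (c - (rho s)\<^sup>2)"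
proof -
  define y where "y = resolvent c (s + h) *v x"
  have "norm (dM s h y + M h *v y) \<le> (2 * rho s * lipA * norm h + lipA\<^sup>2 * (norm h)\<^sup>2) * norm y"
    using norm_triangle_ineq[of "dM s h y" "M h *v y"] norm_dM_le[of s h y] norm_M_le_lipA[of h y]
    by (simp add: algebra_simps)
  then have "norm (resolvent c s *v (dM s h y + M h *v y))
      \<le> (2 * rho s * lipA * norm h + lipA\<^sup>2 * (norm h)\<^sup>2) * norm y / (c - (rho s)\<^sup>2)"
    using c by (intro order_trans[OF norm_resolvent_le[OF c]] divide_right_mono) auto
  then show ?thesis
    using resolvent_diff[OF c c', of x] by (simp add: y_def)
qed

lemma norm_resolvent_remainder_le:
  "norm (resolvent c (s + h) *v x - resolvent c s *v x - resolvent c s *v dM s h (resolvent c s *v x))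
    \<le> (2 * rho s * lipA * norm h * norm (resolvent c (s + h) *v x - resolvent c s *v x)
       + lipA\<^sup>2 * (norm h)\<^sup>2 * norm (resolvent c (s + h) *v x)) / (c - (rho s)\<^sup>2)"
proof -
  define y1 where "y1 = resolvent c (s + h) *v x"
  define y0 where "y0 = resolvent c s *v x"
  have diff: "y1 - y0 = resolvent c s *v (dM s h y1 + M h *v y1)"
    using resolvent_diff[OF c c', of x] by (simp add: y1_def y0_def)
  have "resolvent c s *v (dM s h (y1 - y0) + M h *v y1)
      = resolvent c s *v (dM s h y1 + M h *v y1) - resolvent c s *v dM s h y0"
    by (simp only: dM_vec_diff matrix_vector_right_distrib matrix_vector_mult_diff_distrib) simp
  then have "y1 - y0 - resolvent c s *v dM s h y0 = resolvent c s *v (dM s h (y1 - y0) + M h *v y1)"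
    unfolding diff[symmetric] by (rule sym)
  moreover have "norm (dM s h (y1 - y0) + M h *v y1)
      \<le> 2 * rho s * lipA * norm h * norm (y1 - y0) + lipA\<^sup>2 * (norm h)\<^sup>2 * norm y1"
    using norm_triangle_ineq[of "dM s h (y1 - y0)" "M h *v y1"] norm_dM_le[of s h "y1 - y0"]
      norm_M_le_lipA[of h y1] by simp
  then have "norm (resolvent c s *v (dM s h (y1 - y0) + M h *v y1))
      \<le> (2 * rho s * lipA * norm h * norm (y1 - y0) + lipA\<^sup>2 * (norm h)\<^sup>2 * norm y1) / (c - (rho s)\<^sup>2)"
    using c by (intro order_trans[OF norm_resolvent_le[OF c]] divide_right_mono) auto
  ultimately show ?thesis by (simp add: y1_def y0_def)
qed

end

text \<open>Where the gap \<open>c - \<rho>\<^sup>2\<close> stays above half its value at \<open>s\<close> the resolvent is bounded, so the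
  two estimates above make the difference linear and the remainder quadratic in \<open>h\<close>.\<close>

lemma resolvent_quadratic_remainder:
  assumes c: "c > (rho s)\<^sup>2"
  obtains C where "\<And>y. c - (rho y)\<^sup>2 > (c - (rho s)\<^sup>2) / 2 \<Longrightarrow> norm (y - s) \<le> 1 \<Longrightarrow>
    norm (resolvent c y *v x - resolvent c s *v x - resolvent c s *v dM s (y - s) (resolvent c s *v x))
      \<le> C * (norm (y - s))\<^sup>2"
proof -
  define g where "g = c - (rho s)\<^sup>2"
  define Y where "Y = 2 * norm x / g"
  define C1 where "C1 = (2 * rho s * lipA + lipA\<^sup>2) * Y / g"
  have g: "g > 0" using c by (simp add: g_def)
  have Y: "Y \<ge> 0" and C1: "C1 \<ge> 0" using g rho_nonneg lipA_nonneg by (simp_all add: Y_def C1_def)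
  show ?thesis
  proof (rule that[of "(2 * rho s * lipA * C1 + lipA\<^sup>2 * Y) / g"])
    fix y assume gap: "c - (rho y)\<^sup>2 > (c - (rho s)\<^sup>2) / 2" and y1: "norm (y - s) \<le> 1"
    define h where "h = y - s"
    have y: "y = s + h" and h1: "norm h \<le> 1" and hh: "(norm h)\<^sup>2 \<le> norm h"
      using y1 by (simp_all add: h_def power2_eq_square mult_left_le_one_le)
    have c': "c > (rho (s + h))\<^sup>2" using gap g by (simp add: g_def y)
    have "norm (resolvent c (s + h) *v x) \<le> norm x / (c - (rho (s + h))\<^sup>2)"
      by (rule norm_resolvent_le[OF c'])
    also have "\<dots> \<le> norm x / (g / 2)"
      using gap g by (intro divide_left_mono) (simp_all add: g_def y)
    also have "\<dots> = Y" by (simp add: Y_def)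
    finally have ny: "norm (resolvent c (s + h) *v x) \<le> Y" .
    have "2 * rho s * lipA * norm h + lipA\<^sup>2 * (norm h)\<^sup>2 \<le> (2 * rho s * lipA + lipA\<^sup>2) * norm h"
      using hh by (simp add: distrib_right mult_left_mono)
    then have "(2 * rho s * lipA * norm h + lipA\<^sup>2 * (norm h)\<^sup>2) * norm (resolvent c (s + h) *v x)
        \<le> ((2 * rho s * lipA + lipA\<^sup>2) * norm h) * Y"
      using ny rho_nonneg[of s] lipA_nonneg by (intro mult_mono) auto
    then have nd: "norm (resolvent c (s + h) *v x - resolvent c s *v x) \<le> C1 * norm h"
      using norm_resolvent_diff_le[OF c c', of x] g
      by (simp add: C1_def g_def[symmetric] divide_le_eq) (simp add: field_simps)
    have "2 * rho s * lipA * norm h * norm (resolvent c (s + h) *v x - resolvent c s *v x)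
        + lipA\<^sup>2 * (norm h)\<^sup>2 * norm (resolvent c (s + h) *v x)
        \<le> 2 * rho s * lipA * norm h * (C1 * norm h) + lipA\<^sup>2 * (norm h)\<^sup>2 * Y"
      using nd ny rho_nonneg[of s] lipA_nonneg by (intro add_mono mult_left_mono) auto
    then show "norm (resolvent c y *v x - resolvent c s *v x - resolvent c s *v dM s (y - s) (resolvent c s *v x))
        \<le> (2 * rho s * lipA * C1 + lipA\<^sup>2 * Y) / g * (norm (y - s))\<^sup>2"
      using norm_resolvent_remainder_le[OF c c', of x] g
      unfolding y h_def[symmetric] g_def[symmetric]
      by (simp add: divide_le_eq) (simp add: power2_eq_square field_simps)
  qed
qed

lemma has_derivative_resolvent:
  assumes c: "c > (rho s)\<^sup>2"
  shows "((\<lambda>s. resolvent c s *v x) has_derivative (\<lambda>h. resolvent c s *v dM s h (resolvent c s *v x))) (at s)"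
proof -
  obtain C where C: "\<And>y. c - (rho y)\<^sup>2 > (c - (rho s)\<^sup>2) / 2 \<Longrightarrow> norm (y - s) \<le> 1 \<Longrightarrow>
    norm (resolvent c y *v x - resolvent c s *v x - resolvent c s *v dM s (y - s) (resolvent c s *v x))
      \<le> C * (norm (y - s))\<^sup>2"
    using resolvent_quadratic_remainder[OF c] by blast
  have "\<forall>\<^sub>F y in at s. norm (y - s) < 1"
    unfolding eventually_at by (intro exI[of _ 1]) (simp add: dist_norm)
  with eventually_resolvent_gap[OF c]
  have "\<forall>\<^sub>F y in at s. norm (resolvent c y *v x - resolvent c s *v x
      - resolvent c s *v dM s (y - s) (resolvent c s *v x)) \<le> C * (norm (y - s))\<^sup>2"
    by eventually_elim (use C in auto)
  moreover have "bounded_linear (\<lambda>h. resolvent c s *v dM s h (resolvent c s *v x))"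
    by (simp add: linear_conv_bounded_linear[symmetric] linearI dM_dir_add dM_dir_scale
        matrix_vector_right_distrib matrix_vector_mult_scaleR)
  ultimately show ?thesis by (intro has_derivative_quadratic_remainder)
qed

definition res_x :: "real^'q \<Rightarrow> nat \<Rightarrow> real^'m \<Rightarrow> real^'q" where
  "res_x x n s = resolvent (pole_sq n) s *v x"

definition phi_term_d1 :: "real^'q \<Rightarrow> nat \<Rightarrow> real^'m \<Rightarrow> real^'m \<Rightarrow> real" where
  "phi_term_d1 x n s w = -2 * pole_sq n * (res_x x n s \<bullet> dM s w (res_x x n s))"

definition phi_term_d2 :: "real^'q \<Rightarrow> nat \<Rightarrow> real^'m \<Rightarrow> real^'m \<Rightarrow> real^'m \<Rightarrow> real" where
  "phi_term_d2 x n s h w = -2 * pole_sq n *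
     ((resolvent (pole_sq n) s *v dM s h (res_x x n s)) \<bullet> dM s w (res_x x n s)
      + res_x x n s \<bullet> dM h w (res_x x n s)
      + res_x x n s \<bullet> dM s w (resolvent (pole_sq n) s *v dM s h (res_x x n s)))"

lemma phi_term_d2_eq:
  fixes x :: "real^'q" and n s
  defines "y \<equiv> res_x x n s"
  shows "phi_term_d2 x n s h w = -2 * pole_sq n *
    (2 * ((resolvent (pole_sq n) s *v dM s h y) \<bullet> dM s w y) + y \<bullet> dM h w y)"
  using dM_self_adjoint[of s w y "resolvent (pole_sq n) s *v dM s h y"]
    inner_commute[of "dM s w y" "resolvent (pole_sq n) s *v dM s h y"]
  by (simp add: phi_term_d2_def y_def[symmetric] algebra_simps)

lemma has_derivative_dM:
  assumes "(f has_derivative f') (at s)"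
  shows "((\<lambda>s. dM s w (f s)) has_derivative (\<lambda>h. dM h w (f s) + dM s w (f' h))) (at s)"
proof -
  note mv = bounded_bilinear.FDERIV[OF bounded_bilinear_matrix_vector_mult]
  have A: "(A has_derivative A) (at s)"
    by (rule bounded_linear_imp_has_derivative) (simp add: linear_conv_bounded_linear[symmetric] linear_A)
  have "((\<lambda>s. - (A s *v (A w *v f s)) - A w *v (A s *v f s)) has_derivative
      (\<lambda>h. - (A s *v (A w *v f' h + 0 *v f s) + A h *v (A w *v f s))
           - (A w *v (A s *v f' h + A h *v f s) + 0 *v (A s *v f s)))) (at s)"
    by (intro has_derivative_diff has_derivative_minus mv[OF A] mv[OF has_derivative_const] assms)
  then show ?thesis
    unfolding dM_def by (rule has_derivative_eq_rhs) (simp add: fun_eq_iff matrix_vector_right_distrib algebra_simps)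
qed

context
  fixes n s
  assumes c: "pole_sq n > (rho s)\<^sup>2"
begin

lemma has_derivative_res_x:
  "(res_x x n has_derivative (\<lambda>h. resolvent (pole_sq n) s *v dM s h (res_x x n s))) (at s)"
  unfolding res_x_def[abs_def] using has_derivative_resolvent[OF c] by simp

lemma has_derivative_phi_term: "(phi_term x n has_derivative phi_term_d1 x n s) (at s)"
proof -
  have "((\<lambda>s. 2 * (x \<bullet> x) - 2 * pole_sq n * (x \<bullet> res_x x n s)) has_derivative
        (\<lambda>h. 0 - 2 * pole_sq n * (x \<bullet> (resolvent (pole_sq n) s *v dM s h (res_x x n s))))) (at s)"
    by (intro derivative_intros has_derivative_res_x)
  moreover have "x \<bullet> (resolvent (pole_sq n) s *v dM s h (res_x x n s)) = res_x x n s \<bullet> dM s h (res_x x n s)" for h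
    using resolvent_self_adjoint[OF c] by (simp add: res_x_def)
  ultimately show ?thesis
    by (simp add: phi_term_def[abs_def] phi_term_d1_def[abs_def] res_x_def)
qed

lemma has_derivative_phi_term_d1:
  "((\<lambda>s. phi_term_d1 x n s w) has_derivative (\<lambda>h. phi_term_d2 x n s h w)) (at s)"
proof -
  have "((\<lambda>s. -2 * pole_sq n * (res_x x n s \<bullet> dM s w (res_x x n s))) has_derivative
      (\<lambda>h. -2 * pole_sq n * (res_x x n s \<bullet> (dM h w (res_x x n s)
          + dM s w (resolvent (pole_sq n) s *v dM s h (res_x x n s)))
        + (resolvent (pole_sq n) s *v dM s h (res_x x n s)) \<bullet> dM s w (res_x x n s)))) (at s)"
    by (intro has_derivative_mult_right has_derivative_inner has_derivative_res_x
        has_derivative_dM[OF has_derivative_res_x])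
  then show ?thesis
    unfolding phi_term_d1_def
    by (rule has_derivative_eq_rhs) (simp add: fun_eq_iff phi_term_d2_def inner_add_right algebra_simps)
qed

end

context
  fixes r s
  assumes r: "rho s < r" "r < pi"
begin

lemma pole_sq_gt_rho: "pole_sq n > (rho s)\<^sup>2"
  by (rule pole_sq_gt[OF rho_nonneg]) (use r in simp)

lemma pole_sq_norm_res_x_le:
  "pole_sq n * (norm (res_x x n s))\<^sup>2 \<le> (norm x)\<^sup>2 * (pi\<^sup>2 / (pi\<^sup>2 - r\<^sup>2)\<^sup>2) * inverse ((real (Suc n))\<^sup>2)"
proof -
  have r0: "0 \<le> r" using rho_nonneg[of s] r by simp
  have cr: "pole_sq n > r\<^sup>2" by (rule pole_sq_gt[OF r0 r(2)])
  have "(rho s)\<^sup>2 \<le> r\<^sup>2" using r rho_nonneg[of s] by (intro power_mono) auto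
  have "norm (res_x x n s) \<le> norm x / (pole_sq n - (rho s)\<^sup>2)"
    unfolding res_x_def by (rule norm_resolvent_le[OF pole_sq_gt_rho])
  also have "\<dots> \<le> norm x / (pole_sq n - r\<^sup>2)"
    using \<open>(rho s)\<^sup>2 \<le> r\<^sup>2\<close> cr by (intro divide_left_mono) auto
  finally have "pole_sq n * (norm (res_x x n s))\<^sup>2 \<le> pole_sq n * (norm x / (pole_sq n - r\<^sup>2))\<^sup>2"
    by (intro mult_left_mono power_mono) (simp_all add: pole_sq_def)
  also have "\<dots> = (norm x)\<^sup>2 * (pole_sq n / (pole_sq n - r\<^sup>2)\<^sup>2)"
    by (simp add: power_divide)
  also have "\<dots> \<le> (norm x)\<^sup>2 * (pi\<^sup>2 / (pi\<^sup>2 - r\<^sup>2)\<^sup>2 * inverse ((real (Suc n))\<^sup>2))"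
    by (intro mult_left_mono pole_sq_ratio_le[OF r0 r(2)]) simp
  finally show ?thesis by (simp add: mult.assoc)
qed

lemma norm_dM_le_radius: "norm (dM s h v) \<le> 2 * r * lipA * norm h * norm v"
  using r lipA_nonneg by (intro order_trans[OF norm_dM_le] mult_right_mono) auto

lemma abs_phi_term_d1_le:
  "\<bar>phi_term_d1 x n s h\<bar> \<le> (4 * r * lipA * (norm x)\<^sup>2 * (pi\<^sup>2 / (pi\<^sup>2 - r\<^sup>2)\<^sup>2)
     * inverse ((real (Suc n))\<^sup>2)) * norm h"
proof -
  define y where "y = res_x x n s"
  have r0: "0 \<le> r" using rho_nonneg[of s] r by simp
  have c0: "pole_sq n \<ge> 0" by (simp add: pole_sq_def)
  have "\<bar>phi_term_d1 x n s h\<bar> = 2 * pole_sq n * \<bar>y \<bullet> dM s h y\<bar>"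
    by (simp add: phi_term_d1_def y_def abs_mult pole_sq_def)
  also have "\<dots> \<le> 2 * pole_sq n * (norm y * (2 * r * lipA * norm h * norm y))"
    using c0 norm_dM_le_radius[of h y]
    by (intro mult_left_mono order_trans[OF Cauchy_Schwarz_ineq2]) auto
  also have "\<dots> = (4 * r * lipA * norm h) * (pole_sq n * (norm y)\<^sup>2)"
    by (simp add: power2_eq_square algebra_simps)
  also have "\<dots> \<le> (4 * r * lipA * norm h) * ((norm x)\<^sup>2 * (pi\<^sup>2 / (pi\<^sup>2 - r\<^sup>2)\<^sup>2) * inverse ((real (Suc n))\<^sup>2))"
    using r0 lipA_nonneg unfolding y_def by (intro mult_left_mono pole_sq_norm_res_x_le) auto
  finally show ?thesis by (simp add: algebra_simps)
qed

lemma norm_resolvent_dM_le: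
  "norm (resolvent (pole_sq n) s *v dM s h v) \<le> 2 * r * lipA * norm h * norm v / (pi\<^sup>2 - r\<^sup>2)"
proof -
  have r0: "0 \<le> r" using rho_nonneg[of s] r by simp
  have "(rho s)\<^sup>2 \<le> r\<^sup>2" using r rho_nonneg[of s] by (intro power_mono) auto
  moreover have "pi\<^sup>2 - (rho s)\<^sup>2 \<le> (real (Suc n))\<^sup>2 * (pi\<^sup>2 - (rho s)\<^sup>2)"
    using r rho_nonneg[of s] mult_right_mono[of 1 "(real (Suc n))\<^sup>2" "pi\<^sup>2 - (rho s)\<^sup>2"]
    by (simp add: power_strict_mono)
  ultimately have gap: "pole_sq n - (rho s)\<^sup>2 \<ge> pi\<^sup>2 - r\<^sup>2"
    using pole_sq_gap[OF rho_nonneg, of s n] r by linarith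
  have "norm (resolvent (pole_sq n) s *v dM s h v) \<le> norm (dM s h v) / (pole_sq n - (rho s)\<^sup>2)"
    by (rule norm_resolvent_le[OF pole_sq_gt_rho])
  also have "\<dots> \<le> 2 * r * lipA * norm h * norm v / (pi\<^sup>2 - r\<^sup>2)"
    using gap r r0 lipA_nonneg norm_dM_le_radius[of h v]
    by (intro frac_le) (auto simp: power_strict_mono)
  finally show ?thesis .
qed

lemma abs_phi_term_d2_le_norm_res_x:
  "\<bar>phi_term_d2 x n s h w\<bar>
     \<le> 2 * lipA\<^sup>2 * (8 * r\<^sup>2 / (pi\<^sup>2 - r\<^sup>2) + 2) * norm h * norm w * (pole_sq n * (norm (res_x x n s))\<^sup>2)"
proof -
  define y where "y = res_x x n s"
  define z where "z = resolvent (pole_sq n) s *v dM s h y"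
  have pr: "pi\<^sup>2 - r\<^sup>2 > 0" using r rho_nonneg[of s] by (simp add: power_strict_mono)
  have "\<bar>z \<bullet> dM s w y\<bar> \<le> (2 * r * lipA * norm h * norm y / (pi\<^sup>2 - r\<^sup>2)) * (2 * r * lipA * norm w * norm y)"
    unfolding z_def using r rho_nonneg[of s] lipA_nonneg pr
    by (intro order_trans[OF Cauchy_Schwarz_ineq2] mult_mono norm_resolvent_dM_le norm_dM_le_radius) auto
  moreover have "\<bar>y \<bullet> dM h w y\<bar> \<le> norm y * (2 * lipA\<^sup>2 * norm h * norm w * norm y)"
    by (intro order_trans[OF Cauchy_Schwarz_ineq2] mult_left_mono norm_dM_le_lipA) simp
  moreover have "(2 * r * lipA * norm h * norm y / (pi\<^sup>2 - r\<^sup>2)) * (2 * r * lipA * norm w * norm y) * 2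
      + norm y * (2 * lipA\<^sup>2 * norm h * norm w * norm y)
      = (norm y)\<^sup>2 * norm h * norm w * lipA\<^sup>2 * (8 * r\<^sup>2 / (pi\<^sup>2 - r\<^sup>2) + 2)"
    using pr by (simp add: power2_eq_square field_simps)
  ultimately have bound: "\<bar>2 * (z \<bullet> dM s w y) + y \<bullet> dM h w y\<bar>
      \<le> (norm y)\<^sup>2 * norm h * norm w * lipA\<^sup>2 * (8 * r\<^sup>2 / (pi\<^sup>2 - r\<^sup>2) + 2)"
    by linarith
  have "\<bar>phi_term_d2 x n s h w\<bar> = 2 * pole_sq n * \<bar>2 * (z \<bullet> dM s w y) + y \<bullet> dM h w y\<bar>"
    unfolding phi_term_d2_eq y_def[symmetric] z_def[symmetric] by (simp add: abs_mult pole_sq_def)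
  also have "\<dots> \<le> 2 * pole_sq n * ((norm y)\<^sup>2 * norm h * norm w * lipA\<^sup>2 * (8 * r\<^sup>2 / (pi\<^sup>2 - r\<^sup>2) + 2))"
    by (rule mult_left_mono[OF bound]) (simp add: pole_sq_def)
  finally show ?thesis by (simp add: y_def mult_ac)
qed


lemma abs_phi_term_d2_le:
  "\<bar>phi_term_d2 x n s h w\<bar> \<le> (2 * lipA\<^sup>2 * (8 * r\<^sup>2 / (pi\<^sup>2 - r\<^sup>2) + 2) * (norm x)\<^sup>2
     * (pi\<^sup>2 / (pi\<^sup>2 - r\<^sup>2)\<^sup>2) * inverse ((real (Suc n))\<^sup>2)) * norm h * norm w"
proof -
  define K where "K = 2 * lipA\<^sup>2 * (8 * r\<^sup>2 / (pi\<^sup>2 - r\<^sup>2) + 2) * norm h * norm w"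
  have "K \<ge> 0"
    using r rho_nonneg[of s] by (simp add: K_def power_strict_mono)
  have "\<bar>phi_term_d2 x n s h w\<bar> \<le> K * (pole_sq n * (norm (res_x x n s))\<^sup>2)"
    unfolding K_def by (rule abs_phi_term_d2_le_norm_res_x)
  also have "\<dots> \<le> K * ((norm x)\<^sup>2 * (pi\<^sup>2 / (pi\<^sup>2 - r\<^sup>2)\<^sup>2) * inverse ((real (Suc n))\<^sup>2))"
    by (rule mult_left_mono[OF pole_sq_norm_res_x_le \<open>K \<ge> 0\<close>])
  finally show ?thesis by (simp add: K_def algebra_simps)
qed

end

definition phi_d1 :: "real^'q \<Rightarrow> real^'m \<Rightarrow> real^'m \<Rightarrow> real^'m \<Rightarrow> real" where
  "phi_d1 x t s w = (\<Sum>n. phi_term_d1 x n s w) + 4 * (t \<bullet> w)"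

definition phi_d2 :: "real^'q \<Rightarrow> real^'m \<Rightarrow> real^'m \<Rightarrow> real^'m \<Rightarrow> real" where
  "phi_d2 x s h w = (\<Sum>n. phi_term_d2 x n s h w)"

context
  fixes r s
  assumes r: "rho s < r" "r < pi"
begin

lemma summable_phi_term_d1: "summable (\<lambda>n. phi_term_d1 x n s h)"
proof (rule summable_comparison_test'[OF summable_mult2[OF summable_mult[OF summable_inverse_Suc_squared]]])
  show "norm (phi_term_d1 x n s h) \<le> 4 * r * lipA * (norm x)\<^sup>2 * (pi\<^sup>2 / (pi\<^sup>2 - r\<^sup>2)\<^sup>2)
      * inverse ((real (Suc n))\<^sup>2) * norm h" for n
    using abs_phi_term_d1_le[OF r] by simp
qed

lemma summable_phi_term_d2: "summable (\<lambda>n. phi_term_d2 x n s h w)"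
proof (rule summable_comparison_test'[OF summable_mult2[OF summable_mult2[OF
        summable_mult[OF summable_inverse_Suc_squared]]]])
  show "norm (phi_term_d2 x n s h w) \<le> 2 * lipA\<^sup>2 * (8 * r\<^sup>2 / (pi\<^sup>2 - r\<^sup>2) + 2) * (norm x)\<^sup>2
      * (pi\<^sup>2 / (pi\<^sup>2 - r\<^sup>2)\<^sup>2) * inverse ((real (Suc n))\<^sup>2) * norm h * norm w" for n
    using abs_phi_term_d2_le[OF r] by simp
qed

end

lemma has_derivative_suminf_phi_term:
  assumes "rho s < pi"
  shows "((\<lambda>s. \<Sum>n. phi_term x n s) has_derivative (\<lambda>h. \<Sum>n. phi_term_d1 x n s h)) (at s)"
proof -
  obtain r where r: "rho s < r" "r < pi" using dense[OF assms] by blast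
  define C where "C = 4 * r * lipA * (norm x)\<^sup>2 * (pi\<^sup>2 / (pi\<^sup>2 - r\<^sup>2)\<^sup>2)"
  show ?thesis
  proof (rule has_derivative_suminf[OF rho_sublevel[of r], where D = "\<lambda>n. C * inverse ((real (Suc n))\<^sup>2)"])
    fix n y assume "y \<in> {s. rho s < r}"
    then have y: "rho y < r" by simp
    show "(phi_term x n has_derivative phi_term_d1 x n y) (at y)"
      by (rule has_derivative_phi_term[OF pole_sq_gt_rho[OF y r(2)]])
    show "\<bar>phi_term_d1 x n y h\<bar> \<le> C * inverse ((real (Suc n))\<^sup>2) * norm h" for h
      unfolding C_def by (rule abs_phi_term_d1_le[OF y r(2)])
    show "summable (\<lambda>n. phi_term x n y)" using y r by (intro summable_phi_term) simp
  next
    show "summable (\<lambda>n. C * inverse ((real (Suc n))\<^sup>2))"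
      by (rule summable_mult[OF summable_inverse_Suc_squared])
  qed (use r in simp_all)
qed

lemma has_derivative_suminf_phi_term_d1:
  assumes "rho s < pi"
  shows "((\<lambda>s. \<Sum>n. phi_term_d1 x n s w) has_derivative (\<lambda>h. \<Sum>n. phi_term_d2 x n s h w)) (at s)"
proof -
  obtain r where r: "rho s < r" "r < pi" using dense[OF assms] by blast
  define C where "C = 2 * lipA\<^sup>2 * (8 * r\<^sup>2 / (pi\<^sup>2 - r\<^sup>2) + 2) * (norm x)\<^sup>2 * (pi\<^sup>2 / (pi\<^sup>2 - r\<^sup>2)\<^sup>2)"
  show ?thesis
  proof (rule has_derivative_suminf[OF rho_sublevel[of r],
        where D = "\<lambda>n. C * inverse ((real (Suc n))\<^sup>2) * norm w"])
    fix n y assume "y \<in> {s. rho s < r}"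
    then have y: "rho y < r" by simp
    show "((\<lambda>s. phi_term_d1 x n s w) has_derivative (\<lambda>h. phi_term_d2 x n y h w)) (at y)"
      by (rule has_derivative_phi_term_d1[OF pole_sq_gt_rho[OF y r(2)]])
    show "\<bar>phi_term_d2 x n y h w\<bar> \<le> C * inverse ((real (Suc n))\<^sup>2) * norm w * norm h" for h
      using abs_phi_term_d2_le[OF y r(2), of x n h w] by (simp add: C_def algebra_simps)
    show "summable (\<lambda>n. phi_term_d1 x n y w)" by (rule summable_phi_term_d1[OF y r(2)])
  next
    show "summable (\<lambda>n. C * inverse ((real (Suc n))\<^sup>2) * norm w)"
      by (rule summable_mult2[OF summable_mult[OF summable_inverse_Suc_squared]])
  qed (use r in simp_all)
qed

lemma has_derivative_phi:
  assumes "rho s < pi"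
  shows "(phi Us x t has_derivative phi_d1 x t s) (at s)"
proof -
  have "((\<lambda>s. x \<bullet> x + (\<Sum>n. phi_term x n s) + 4 * (t \<bullet> s)) has_derivative
        (\<lambda>h. 0 + (\<Sum>n. phi_term_d1 x n s h) + 4 * (t \<bullet> h))) (at s)"
    by (intro derivative_intros has_derivative_suminf_phi_term[OF assms])
  then have "((\<lambda>s. x \<bullet> x + (\<Sum>n. phi_term x n s) + 4 * (t \<bullet> s)) has_derivative phi_d1 x t s) (at s)"
    by (simp add: phi_d1_def[abs_def])
  then show ?thesis
    by (rule has_derivative_transform_within_open[OF _ rho_sublevel(1)]) (use assms phi_eq_series in auto)
qed

lemma has_derivative_phi_d1:
  assumes "rho s < pi"
  shows "((\<lambda>s. phi_d1 x t s w) has_derivative (\<lambda>h. phi_d2 x s h w)) (at s)"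
  unfolding phi_d1_def[abs_def] phi_d2_def
  using has_derivative_add[OF has_derivative_suminf_phi_term_d1[OF assms] has_derivative_const]
  by simp

lemma linear_phi_d1: "rho s < pi \<Longrightarrow> linear (phi_d1 x t s)"
  using has_derivative_linear[OF has_derivative_phi] .

lemma linear_phi_d2_dir: "rho s < pi \<Longrightarrow> linear (\<lambda>h. phi_d2 x s h w)"
  using has_derivative_linear[OF has_derivative_phi_d1] .

lemma linear_phi_d2: "rho s < pi \<Longrightarrow> linear (phi_d2 x s h)"
proof -
  assume r: "rho s < pi"
  have "linear (\<lambda>w. phi_term_d2 x n s h w)" for n
    by (intro linearI)
       (simp_all add: phi_term_d2_def dM_dir_add dM_dir_scale matrix_vector_right_distrib
        matrix_vector_mult_scaleR inner_add_right inner_add_left algebra_simps)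
  moreover obtain r' where r': "rho s < r'" "r' < pi" using dense[OF r] by blast
  ultimately show ?thesis
    unfolding phi_d2_def
    by (intro linearI)
       (simp_all add: linear_add linear_scale
        suminf_add[OF summable_phi_term_d2[OF r'] summable_phi_term_d2[OF r']]
        suminf_mult[OF summable_phi_term_d2[OF r']])
qed

subsection \<open>Concavity and flat directions\<close>

definition flat_dir :: "real^'q \<Rightarrow> real^'m \<Rightarrow> real^'m \<Rightarrow> bool" where
  "flat_dir x s w \<longleftrightarrow> (\<forall>n. A w *v res_x x n s = 0 \<and> dM s w (res_x x n s) = 0)"

lemma phi_term_d2_diag:
  fixes x :: "real^'q" and n s
  defines "y \<equiv> res_x x n s"
  shows "phi_term_d2 x n s w w = -4 * pole_sq n *
    ((resolvent (pole_sq n) s *v dM s w y) \<bullet> dM s w y + (A w *v y) \<bullet> (A w *v y))"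
  by (simp add: phi_term_d2_eq y_def[symmetric] inner_dM_self algebra_simps)

lemma phi_term_d2_diag_nonpos:
  assumes "pole_sq n > (rho s)\<^sup>2"
  shows "phi_term_d2 x n s w w \<le> 0"
  using inner_resolvent_nonneg[OF assms] by (simp add: phi_term_d2_diag pole_sq_def)

lemma phi_d2_diag_nonpos:
  assumes "rho s < pi"
  shows "phi_d2 x s w w \<le> 0"
proof -
  obtain r where r: "rho s < r" "r < pi" using dense[OF assms] by blast
  show ?thesis
    unfolding phi_d2_def
    using suminf_le[OF phi_term_d2_diag_nonpos[OF pole_sq_gt[OF rho_nonneg assms]]
        summable_phi_term_d2[OF r] summable_zero] by simp
qed

lemma flat_dir_phi_term_d1: "flat_dir x s w \<Longrightarrow> phi_term_d1 x n s w = 0"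
  by (simp add: flat_dir_def phi_term_d1_def)

lemma flat_dir_phi_d2: "flat_dir x s w \<Longrightarrow> phi_d2 x s v w = 0"
proof -
  assume "flat_dir x s w"
  then have "A w *v res_x x n s = 0" "dM s w (res_x x n s) = 0" for n
    by (auto simp: flat_dir_def)
  moreover have "res_x x n s \<bullet> dM s w u = 0" if "dM s w (res_x x n s) = 0" for n u
    using dM_self_adjoint[of s w "res_x x n s" u] that by simp
  moreover have "res_x x n s \<bullet> dM v w (res_x x n s) = 0" if "A w *v res_x x n s = 0" for n
    using inner_dM_self[of "res_x x n s" v w] that by simp
  ultimately show ?thesis by (simp add: phi_d2_def phi_term_d2_def)
qed

lemma phi_d2_diag_eq_0_iff:
  assumes r: "rho s < pi"
  shows "phi_d2 x s w w = 0 \<longleftrightarrow> flat_dir x s w"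
proof
  obtain r' where r': "rho s < r'" "r' < pi" using dense[OF r] by blast
  assume "phi_d2 x s w w = 0"
  then have "(\<lambda>n. - phi_term_d2 x n s w w) sums 0"
    using sums_minus[OF summable_sums[OF summable_phi_term_d2[OF r', of x w w]]] by (simp add: phi_d2_def)
  then have zero: "phi_term_d2 x n s w w = 0" for n
    using sums_unique suminf_eq_zero_iff[of "\<lambda>n. - phi_term_d2 x n s w w"]
      phi_term_d2_diag_nonpos[OF pole_sq_gt[OF rho_nonneg r]]
    by (fastforce simp: sums_iff)
  show "flat_dir x s w"
    unfolding flat_dir_def
  proof
    fix n
    define y where "y = res_x x n s"
    note c = pole_sq_gt[OF rho_nonneg r, of n]
    have "(resolvent (pole_sq n) s *v dM s w y) \<bullet> dM s w y + (A w *v y) \<bullet> (A w *v y) = 0"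
      using zero[of n] by (simp add: phi_term_d2_diag y_def pole_sq_def)
    moreover have "(resolvent (pole_sq n) s *v dM s w y) \<bullet> dM s w y \<ge> 0"
      by (rule inner_resolvent_nonneg[OF c])
    ultimately have "(resolvent (pole_sq n) s *v dM s w y) \<bullet> dM s w y = 0" "(A w *v y) \<bullet> (A w *v y) = 0"
      by (smt (verit) inner_ge_zero)+
    then show "A w *v y = 0 \<and> dM s w y = 0"
      using inner_resolvent_eq_0_iff[OF c] by simp
  qed
qed (rule flat_dir_phi_d2)

lemma flat_dir_shift:
  assumes flat: "flat_dir x s w" and r: "rho s < pi" "rho (s + u *\<^sub>R w) < pi"
  shows "res_x x n (s + u *\<^sub>R w) = res_x x n s" "flat_dir x (s + u *\<^sub>R w) w"
proof -
  have Ay: "A w *v res_x x k s = 0" and dMy: "dM s w (res_x x k s) = 0" for k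
    using flat by (auto simp: flat_dir_def)
  have res_eq: "res_x x k (s + u *\<^sub>R w) = res_x x k s" for k
  proof -
    define y where "y = res_x x k s"
    have "M (u *\<^sub>R w) *v y = 0"
      using Ay[of k] by (simp add: M_mv A_scale scaleR_matrix_vector_mult matrix_vector_mult_scaleR y_def)
    then have "M (s + u *\<^sub>R w) *v y = M s *v y"
      using dMy[of k] unfolding M_add by (simp add: dM_dir_scale y_def)
    then have "(pole_sq k *\<^sub>R mat 1 - M (s + u *\<^sub>R w)) *v y = x"
      using shifted_M_resolvent[OF pole_sq_gt[OF rho_nonneg r(1)], of k x]
      by (simp add: shifted_M_mv y_def res_x_def)
    then show ?thesis
      unfolding res_x_def y_def by (rule resolvent_eqI[OF pole_sq_gt[OF rho_nonneg r(2)]])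
  qed
  then show "res_x x n (s + u *\<^sub>R w) = res_x x n s" .
  have "dM w w (res_x x k s) = 0" for k by (simp add: dM_def Ay)
  then show "flat_dir x (s + u *\<^sub>R w) w"
    by (simp add: flat_dir_def res_eq Ay dM_base_add dM_base_scale dMy)
qed

lemma phi_along_flat_dir:
  assumes flat: "flat_dir x s w" and r: "rho s < pi" "rho (s + u *\<^sub>R w) < pi"
  shows "phi Us x t (s + u *\<^sub>R w) = phi Us x t s + 4 * u * (t \<bullet> w)"
proof -
  have "phi_term x n (s + u *\<^sub>R w) = phi_term x n s" for n
    using flat_dir_shift(1)[OF assms, of n] by (simp add: phi_term_def res_x_def)
  then show ?thesis
    by (simp add: phi_eq_series[OF r(1)] phi_eq_series[OF r(2)] inner_add_right algebra_simps)
qed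

end

section \<open>Critical points and maximizers of \<open>\<phi>\<close>\<close>

lemma linear_Umat: "linear (Umat Us)"
proof -
  have "Complex 0 (a + b) = Complex 0 a + Complex 0 b" "Complex 0 (k * a) = k *\<^sub>R Complex 0 a" for a b k
    by (simp_all add: complex_eq_iff)
  then show ?thesis
    by (intro linearI) (simp_all add: Umat_def vec_eq_iff distrib_right sum.distrib scaleR_sum_right)
qed

lemma convex_Omega: "convex (Omega Us)"
  unfolding Omega_def by (rule convex_strict_sublevel[OF convex_on_onorm_linear_matrix[OF linear_Umat]])

lemma open_Omega: "open (Omega Us)"
  unfolding Omega_def
  by (intro open_Collect_less continuous_on_const
      convex_on_continuous[OF open_UNIV convex_on_onorm_linear_matrix[OF linear_Umat]])

context skew_family
begin

lemma rho_le_onorm_Umat: "rho s \<le> onorm ((*v) (Umat Us s))"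
  unfolding rho_def
proof (rule onorm_le)
  fix v :: "real^'q"
  have "Umat Us s *v vec_of_real v = (\<chi> a. \<i> * complex_of_real ((A s *v v) $ a))"
    by (simp add: Umat_eq vec_of_real_def matrix_vector_mult_def vec_eq_iff sum_distrib_left mult.assoc)
  then have "norm (Umat Us s *v vec_of_real v) = norm (A s *v v)"
    by (simp add: norm_vec_def L2_set_def norm_mult)
  moreover have "norm (Umat Us s *v vec_of_real v) \<le> onorm ((*v) (Umat Us s)) * norm (vec_of_real v)"
    by (rule onorm) simp
  moreover have "norm (vec_of_real v) = norm v"
    by (simp add: vec_of_real_def norm_vec_def L2_set_def)
  ultimately show "norm (A s *v v) \<le> onorm ((*v) (Umat Us s)) * norm v" by simp
qed

lemma Omega_rho_lt_pi: "s \<in> Omega Us \<Longrightarrow> rho s < pi"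
  using rho_le_onorm_Umat[of s] by (simp add: Omega_def)

lemma partial_phi: "rho s < pi \<Longrightarrow> partial (phi Us x t) i s = phi_d1 x t s (axis i 1)"
  by (rule partial_eq_derivative[OF has_derivative_phi])

lemma hess_phi:
  assumes "rho s < pi"
  shows "hess (phi Us x t) s $ i $ j = phi_d2 x s (axis i 1) (axis j 1)"
proof -
  have "((\<lambda>\<sigma>. partial (phi Us x t) j \<sigma>) has_derivative (\<lambda>h. phi_d2 x s h (axis j 1))) (at s)"
    by (rule has_derivative_transform_within_open[OF has_derivative_phi_d1[OF assms] rho_sublevel(1)])
       (use assms partial_phi in auto)
  then show ?thesis unfolding hess_def by (simp add: partial_eq_derivative)
qed

lemma hess_phi_mv:
  assumes "rho s < pi"
  shows "hess (phi Us x t) s *v w = (\<chi> i. phi_d2 x s (axis i 1) w)"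
  using linear_sum_axis[OF linear_phi_d2[OF assms], of x "axis _ 1" w]
  by (simp add: vec_eq_iff matrix_vector_mult_def hess_phi[OF assms] mult.commute)

lemma hess_phi_kernel_iff:
  assumes r: "rho s < pi"
  shows "hess (phi Us x t) s *v w = 0 \<longleftrightarrow> flat_dir x s w"
proof
  assume "hess (phi Us x t) s *v w = 0"
  then have "phi_d2 x s (axis i 1) w = 0" for i
    by (simp add: hess_phi_mv[OF r] vec_eq_iff)
  then have "phi_d2 x s w w = 0"
    using linear_sum_axis[OF linear_phi_d2_dir[OF r], of x w w] by simp
  then show "flat_dir x s w" using phi_d2_diag_eq_0_iff[OF r] by blast
qed (simp add: hess_phi_mv[OF r] flat_dir_phi_d2 vec_eq_iff)

lemma critical_point_iff:
  assumes r: "rho s < pi"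
  shows "(\<forall>i. partial (phi Us x t) i s = 0) \<longleftrightarrow> (\<forall>w. phi_d1 x t s w = 0)"
proof (intro iffI allI)
  fix w
  assume "\<forall>i. partial (phi Us x t) i s = 0"
  then have "phi_d1 x t s (axis i 1) = 0" for i by (simp add: partial_phi[OF r])
  then show "phi_d1 x t s w = 0" by (subst linear_sum_axis[OF linear_phi_d1[OF r]]) simp
qed (simp add: partial_phi[OF r])

lemma phi_along_segment:
  assumes "a \<in> Omega Us" "b \<in> Omega Us" "u \<in> {0..1}"
  shows "a + u *\<^sub>R (b - a) \<in> Omega Us"
    and "((\<lambda>u. phi Us x t (a + u *\<^sub>R (b - a))) has_real_derivative
           phi_d1 x t (a + u *\<^sub>R (b - a)) (b - a)) (at u)"
    and "((\<lambda>u. phi_d1 x t (a + u *\<^sub>R (b - a)) (b - a)) has_real_derivative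
           phi_d2 x (a + u *\<^sub>R (b - a)) (b - a) (b - a)) (at u)"
proof -
  have "a + u *\<^sub>R (b - a) = (1 - u) *\<^sub>R a + u *\<^sub>R b" by (simp add: algebra_simps)
  then show in_Omega: "a + u *\<^sub>R (b - a) \<in> Omega Us"
    using convexD[OF convex_Omega assms(1,2), of "1 - u" u] assms(3) by simp
  show "((\<lambda>u. phi Us x t (a + u *\<^sub>R (b - a))) has_real_derivative
      phi_d1 x t (a + u *\<^sub>R (b - a)) (b - a)) (at u)"
    by (rule has_derivative_along_line[OF has_derivative_phi[OF Omega_rho_lt_pi[OF in_Omega]]])
  show "((\<lambda>u. phi_d1 x t (a + u *\<^sub>R (b - a)) (b - a)) has_real_derivative
      phi_d2 x (a + u *\<^sub>R (b - a)) (b - a) (b - a)) (at u)"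
    by (rule has_derivative_along_line[OF has_derivative_phi_d1[OF Omega_rho_lt_pi[OF in_Omega]]])
qed

lemma phi_decreasing_from_critical_point:
  assumes \<theta>: "\<theta> \<in> Omega Us" and \<tau>: "\<tau> \<in> Omega Us" and crit: "\<forall>w. phi_d1 x t \<theta> w = 0"
    and "0 \<le> a" "a \<le> b" "b \<le> 1"
  shows "phi Us x t (\<theta> + b *\<^sub>R (\<tau> - \<theta>)) \<le> phi Us x t (\<theta> + a *\<^sub>R (\<tau> - \<theta>))"
proof (rule DERIV_nonincreasing_from_critical_point[where b = 1
      and f = "\<lambda>u. phi Us x t (\<theta> + u *\<^sub>R (\<tau> - \<theta>))"
      and f' = "\<lambda>u. phi_d1 x t (\<theta> + u *\<^sub>R (\<tau> - \<theta>)) (\<tau> - \<theta>)"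
      and f'' = "\<lambda>u. phi_d2 x (\<theta> + u *\<^sub>R (\<tau> - \<theta>)) (\<tau> - \<theta>) (\<tau> - \<theta>)"])
  fix u :: real assume u: "u \<in> {0..1}"
  show "((\<lambda>u. phi Us x t (\<theta> + u *\<^sub>R (\<tau> - \<theta>))) has_real_derivative
      phi_d1 x t (\<theta> + u *\<^sub>R (\<tau> - \<theta>)) (\<tau> - \<theta>)) (at u)"
    by (rule phi_along_segment(2)[OF \<theta> \<tau> u])
  show "((\<lambda>u. phi_d1 x t (\<theta> + u *\<^sub>R (\<tau> - \<theta>)) (\<tau> - \<theta>)) has_real_derivative
      phi_d2 x (\<theta> + u *\<^sub>R (\<tau> - \<theta>)) (\<tau> - \<theta>) (\<tau> - \<theta>)) (at u)"
    by (rule phi_along_segment(3)[OF \<theta> \<tau> u])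
  show "phi_d2 x (\<theta> + u *\<^sub>R (\<tau> - \<theta>)) (\<tau> - \<theta>) (\<tau> - \<theta>) \<le> 0"
    by (rule phi_d2_diag_nonpos[OF Omega_rho_lt_pi[OF phi_along_segment(1)[OF \<theta> \<tau> u]]])
qed (use assms in simp_all)

lemma critical_point_is_maximum:
  assumes "\<theta> \<in> Omega Us" "\<tau> \<in> Omega Us" "\<forall>w. phi_d1 x t \<theta> w = 0"
  shows "phi Us x t \<tau> \<le> phi Us x t \<theta>"
  using phi_decreasing_from_critical_point[OF assms, of 0 1] by simp

text \<open>A second maximizer would make \<open>\<phi>\<close> constant on the segment to it, whose direction is then
  flat at the midpoint and so, by \<open>flat_dir_shift\<close>, at \<open>\<theta>\<close>.\<close>

lemma maximizer_eq_nondegenerate_critical_point: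
  assumes \<theta>: "\<theta> \<in> Omega Us" and crit: "\<forall>w. phi_d1 x t \<theta> w = 0"
    and nondeg: "det (hess (phi Us x t) \<theta>) \<noteq> 0"
    and \<theta>': "\<theta>' \<in> Omega Us" and max: "phi Us x t \<theta> \<le> phi Us x t \<theta>'"
  shows "\<theta>' = \<theta>"
proof (rule ccontr)
  assume "\<theta>' \<noteq> \<theta>"
  define w where "w = \<theta>' - \<theta>"
  note seg = phi_along_segment[OF \<theta> \<theta>', folded w_def]
  have const: "phi Us x t (\<theta> + u *\<^sub>R w) = phi Us x t \<theta>" if "u \<in> {0<..<1}" for u
    using phi_decreasing_from_critical_point[OF \<theta> \<theta>' crit, of 0 u]
      phi_decreasing_from_critical_point[OF \<theta> \<theta>' crit, of u 1] that max
    by (simp add: w_def)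
  have "phi_d1 x t (\<theta> + u *\<^sub>R w) w = 0" if "u \<in> {0<..<1}" for u
    using that by (intro DERIV_zero_where_constant[OF const _ seg(2)]) auto
  then have "phi_d2 x (\<theta> + (1/2) *\<^sub>R w) w w = 0"
    by (intro DERIV_zero_where_constant[OF _ _ seg(3)]) auto
  then have "flat_dir x (\<theta> + (1/2) *\<^sub>R w) w"
    using phi_d2_diag_eq_0_iff Omega_rho_lt_pi[OF seg(1)] by auto
  moreover have "\<theta> + (1/2) *\<^sub>R w + (- 1/2) *\<^sub>R w = \<theta>" by (simp add: algebra_simps)
  ultimately have "flat_dir x \<theta> w"
    using flat_dir_shift(2)[of x "\<theta> + (1/2) *\<^sub>R w" w "- 1/2"] Omega_rho_lt_pi[OF seg(1)] Omega_rho_lt_pi[OF \<theta>]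
    by auto
  then have "hess (phi Us x t) \<theta> *v w = 0"
    using hess_phi_kernel_iff[OF Omega_rho_lt_pi[OF \<theta>]] by blast
  moreover have "w \<noteq> 0" using \<open>\<theta>' \<noteq> \<theta>\<close> by (simp add: w_def)
  ultimately show False using nondeg det_eq_0_iff_kernel by blast
qed

lemma critical_point_at_maximizer:
  assumes \<theta>: "\<theta> \<in> Omega Us" and max: "\<forall>\<tau>\<in>Omega Us. phi Us x t \<tau> \<le> phi Us x t \<theta>"
  shows "phi_d1 x t \<theta> (axis i 1) = 0"
proof -
  obtain d where d: "d > 0" "ball \<theta> d \<subseteq> Omega Us"
    using open_Omega \<theta> by (meson open_contains_ball)
  have "\<forall>y. \<bar>0 - y\<bar> < d \<longrightarrow> phi Us x t (\<theta> + y *\<^sub>R axis i 1) \<le> phi Us x t (\<theta> + 0 *\<^sub>R axis i 1)"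
    using d max by (auto simp: dist_norm subset_iff)
  moreover have "((\<lambda>u. phi Us x t (\<theta> + u *\<^sub>R axis i 1)) has_real_derivative
      phi_d1 x t (\<theta> + 0 *\<^sub>R axis i 1) (axis i 1)) (at 0)"
    by (rule has_derivative_along_line) (simp add: has_derivative_phi[OF Omega_rho_lt_pi[OF \<theta>]])
  ultimately show ?thesis using DERIV_local_max[OF _ d(1)] by simp
qed

text \<open>A kernel vector \<open>w\<close> of the Hessian is a flat direction, along which \<open>\<phi>\<close> is affine
  with slope \<open>4 t \<bullet> w\<close>; this is the derivative at the critical point \<open>\<theta>\<close> in direction \<open>w\<close>,
  hence zero.\<close>

lemma maximizer_along_hess_kernel:
  assumes \<theta>: "\<theta> \<in> Omega Us" and max: "\<forall>\<tau>\<in>Omega Us. phi Us x t \<tau> \<le> phi Us x t \<theta>"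
    and ker: "hess (phi Us x t) \<theta> *v w = 0" "w \<noteq> 0"
  obtains \<theta>' where "\<theta>' \<in> Omega Us" "\<theta>' \<noteq> \<theta>" "\<forall>\<tau>\<in>Omega Us. phi Us x t \<tau> \<le> phi Us x t \<theta>'"
proof -
  note r = Omega_rho_lt_pi[OF \<theta>]
  have flat: "flat_dir x \<theta> w" using ker(1) hess_phi_kernel_iff[OF r] by blast
  have "\<forall>w. phi_d1 x t \<theta> w = 0"
    using critical_point_at_maximizer[OF \<theta> max] critical_point_iff[OF r] partial_phi[OF r] by metis
  then have "phi_d1 x t \<theta> w = 0" ..
  then have tw: "t \<bullet> w = 0"
    using flat_dir_phi_term_d1[OF flat] by (simp add: phi_d1_def)
  obtain d where d: "d > 0" "ball \<theta> d \<subseteq> Omega Us"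
    using open_Omega \<theta> by (meson open_contains_ball)
  define u where "u = d / (2 * norm w)"
  have "u > 0" "norm (u *\<^sub>R w) < d" using d ker(2) by (simp_all add: u_def)
  then have \<theta>': "\<theta> + u *\<^sub>R w \<in> Omega Us" "\<theta> + u *\<^sub>R w \<noteq> \<theta>"
    using d ker(2) by (auto simp: dist_norm)
  moreover have "phi Us x t (\<theta> + u *\<^sub>R w) = phi Us x t \<theta>"
    using phi_along_flat_dir[OF flat r Omega_rho_lt_pi[OF \<theta>'(1)]] tw by simp
  ultimately show ?thesis using that max by simp
qed


lemma nondegenerate_critical_point_unique_maximizer:
  assumes \<theta>: "\<theta> \<in> Omega Us" and crit: "\<forall>i. partial (phi Us x t) i \<theta> = 0"
    and nondeg: "det (hess (phi Us x t) \<theta>) \<noteq> 0"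
  shows "{\<theta>'\<in>Omega Us. \<forall>\<tau>\<in>Omega Us. phi Us x t \<tau> \<le> phi Us x t \<theta>'} = {\<theta>}"
proof -
  have crit': "\<forall>w. phi_d1 x t \<theta> w = 0"
    using crit critical_point_iff[OF Omega_rho_lt_pi[OF \<theta>]] by blast
  show ?thesis
    using \<theta> critical_point_is_maximum[OF \<theta> _ crit']
      maximizer_eq_nondegenerate_critical_point[OF \<theta> crit' nondeg] by blast
qed

lemma unique_maximizer_nondegenerate_critical_point:
  assumes S: "{\<theta>'\<in>Omega Us. \<forall>\<tau>\<in>Omega Us. phi Us x t \<tau> \<le> phi Us x t \<theta>'} = {\<theta>}"
  shows "\<theta> \<in> Omega Us" "\<forall>i. partial (phi Us x t) i \<theta> = 0" "det (hess (phi Us x t) \<theta>) \<noteq> 0"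
proof -
  from S show \<theta>: "\<theta> \<in> Omega Us" by blast
  from S have max: "\<forall>\<tau>\<in>Omega Us. phi Us x t \<tau> \<le> phi Us x t \<theta>" by blast
  show "\<forall>i. partial (phi Us x t) i \<theta> = 0"
    using critical_point_at_maximizer[OF \<theta> max] partial_phi[OF Omega_rho_lt_pi[OF \<theta>]] by simp
  show "det (hess (phi Us x t) \<theta>) \<noteq> 0"
  proof
    assume "det (hess (phi Us x t) \<theta>) = 0"
    then obtain w where "hess (phi Us x t) \<theta> *v w = 0" "w \<noteq> 0"
      using det_eq_0_iff_kernel by blast
    with maximizer_along_hess_kernel[OF \<theta> max] S show False by blast
  qed
qed

end

theorem theorem2p4:
  fixes Us :: "'m::finite \<Rightarrow> real^'q::finite^'q"
    and x :: "real^'q" and t :: "real^'m"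
  assumes skew: "\<forall>j. transpose (Us j) = - Us j"
    and indep: "\<forall>c::'m \<Rightarrow> real. (\<Sum>j\<in>UNIV. c j *\<^sub>R Us j) = 0 \<longrightarrow> (\<forall>j. c j = 0)"
  shows "(\<exists>\<theta>\<in>Omega Us. (\<forall>i. partial (phi Us x t) i \<theta> = 0)
                        \<and> det (hess (phi Us x t) \<theta>) \<noteq> 0)
     \<longleftrightarrow> (\<exists>\<theta>. {\<theta>'\<in>Omega Us. \<forall>\<tau>\<in>Omega Us. phi Us x t \<tau> \<le> phi Us x t \<theta>'} = {\<theta>})"
proof -
  interpret skew_family Us using skew by unfold_locales
  show ?thesis
    using nondegenerate_critical_point_unique_maximizer unique_maximizer_nondegenerate_critical_point
    by blast
qed

end
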